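(* Fix $T>1$, $\lambda>0$ and let $f_0(x)=(x+\tfrac12)\wedge\tfrac32$ on $[0,T]$. Consider a generalized compound Poisson process prior with intensity $\lambda$ whose starting value and jump heights $(a_0,\dots,a_K)$, given the number of jumps $K$, have joint Lebesgue density $g_K(\mathbf{a})=\prod_{k=0}^Kg_k(a_k)$, where there exist constants $c>0$, $\gamma\ge0$ such that $g_k(x)\ge cx^\gamma$ for all $x\in[0,1]$ and all $k\ge0$, and where the jump densities $g_k$, $k\ge1$, are supported on $[0,\infty)$. Then there exists a positive constant $\widetilde c$ such that for the marginal posterior of the functional $\vartheta=\int_0^1f$, $$E_{f_0}\Big[\Pi\Big(\vartheta\ge\int_0^1f_0(x)\,dx-\widetilde c\sqrt{\frac{\log n}{n}}\;\Big|\;N\Big)\Big]\to0\quad\text{as }n\to\infty.$$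
   Context: Model: $P_f$ (expectation $E_f$) is the law of a Poisson point process $N=\sum_i\delta_{(X_i,Y_i)}$ on $[0,T]\times\mathbb{R}$ with intensity $n\mathbf{1}(f(x)\le y)$ with respect to Lebesgue measure. Prior: the number $K$ of jumps is Poisson($\lambda$); given $K$, the jump times $0\le t_1\le\dots\le t_K\le1$ are the order statistics of $K$ i.i.d. $U([0,1])$ variables, independent of $(a_0,\dots,a_K)$, which has density $g_K$; $f=\sum_{k=0}^Ka_k\mathbf{1}_{[t_k,T]}$ with $t_0=0$ (so $f$ is constant on $[1,T]$). Posterior: $\Pi(B\mid N)=\frac{\int_Be^{n\int_0^Tf}\mathbf{1}(\forall i:f(X_i)\le Y_i)d\Pi(f)}{\int e^{n\int_0^Tf}\mathbf{1}(\forall i:f(X_i)\le Y_i)d\Pi(f)}$. $\wedge$ denotes minimum. *)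

theory Defs
  imports "HOL-Probability.Probability"
begin

text \<open>
  Point configurations. The point measure \<open>N = \<Sum>\<^sub>i \<delta>(X\<^sub>i, Y\<^sub>i)\<close> is represented by the set of
  its points; since the intensity measures considered here have no atoms, the points of the
  Poisson process are almost surely distinct. \<open>pt_count N A\<close> is \<open>N(A)\<close>.
\<close>

definition pt_count :: "'a set \<Rightarrow> 'a set \<Rightarrow> ennreal" where
  "pt_count N A = emeasure (count_space UNIV) (N \<inter> A)"

definition locally_finite_configs :: "(real \<times> real) set \<Rightarrow> (real \<times> real) set set" where
  "locally_finite_configs E = {N. N \<subseteq> E \<and> (\<forall>B. bounded B \<longrightarrow> finite (N \<inter> B))}"

definition config_space :: "(real \<times> real) set \<Rightarrow> (real \<times> real) set measure" where
  "config_space E = sigma (locally_finite_configs E)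
     {{N \<in> locally_finite_configs E. pt_count N A = of_nat k} | A k. A \<in> sets borel}"

text \<open>
  \<open>P\<close> is the law of a Poisson point process on \<open>E\<close> with intensity measure \<open>\<mu>\<close>. This
  determines \<open>P\<close> uniquely when \<open>\<mu>\<close> is finite on bounded sets. The Poisson probabilities are
  written out because \<open>poisson_pmf\<close> is only specified for a strictly positive rate.
\<close>

definition is_poisson_process_law ::
    "(real \<times> real) set \<Rightarrow> (real \<times> real) measure \<Rightarrow> (real \<times> real) set measure \<Rightarrow> bool" where
  "is_poisson_process_law E \<mu> P \<longleftrightarrow>
     prob_space P \<and> sets P = sets (config_space E) \<and>
     (\<forall>A \<in> sets borel. emeasure \<mu> A < \<infinity> \<longrightarrow>
        (\<forall>k. measure P {N \<in> space P. pt_count N A = of_nat k} =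
             measure \<mu> A ^ k / fact k * exp (- measure \<mu> A))) \<and>
     (\<forall>(I :: nat set) A. finite I \<longrightarrow> (\<forall>i\<in>I. A i \<in> sets borel) \<longrightarrow> disjoint_family_on A I \<longrightarrow>
        prob_space.indep_vars P (\<lambda>_. borel) (\<lambda>i N. pt_count N (A i)) I)"

definition strip :: "real \<Rightarrow> (real \<times> real) set" where
  "strip T = {0..T} \<times> UNIV"

definition boundary_intensity :: "real \<Rightarrow> nat \<Rightarrow> (real \<Rightarrow> real) \<Rightarrow> (real \<times> real) measure" where
  "boundary_intensity T n f =
     density lborel (\<lambda>p. of_nat n * indicator {(x, y). x \<in> {0..T} \<and> f x \<le> y} p)"

definition is_model_law :: "real \<Rightarrow> nat \<Rightarrow> (real \<Rightarrow> real) \<Rightarrow> (real \<times> real) set measure \<Rightarrow> bool" where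
  "is_model_law T n f P \<longleftrightarrow> is_poisson_process_law (strip T) (boundary_intensity T n f) P"

text \<open>
  \<open>jump_time K u k\<close> is the \<open>k\<close>-th smallest of \<open>u 1, \<dots>, u K\<close>, with \<open>t\<^sub>0 = 0\<close>.
\<close>

definition jump_time :: "nat \<Rightarrow> (nat \<Rightarrow> real) \<Rightarrow> nat \<Rightarrow> real" where
  "jump_time K u k = (if k = 0 then 0 else sort (map u [1..<Suc K]) ! (k - 1))"

definition step_path :: "real \<Rightarrow> nat \<Rightarrow> (nat \<Rightarrow> real) \<times> (nat \<Rightarrow> real) \<Rightarrow> real \<Rightarrow> real" where
  "step_path T K = (\<lambda>(u, a) x. \<Sum>k\<le>K. a k * indicator {jump_time K u k..T} x)"

definition coord_space :: "nat \<Rightarrow> ((nat \<Rightarrow> real) \<times> (nat \<Rightarrow> real)) measure" where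
  "coord_space K = (\<Pi>\<^sub>M i\<in>{1..K}. borel) \<Otimes>\<^sub>M (\<Pi>\<^sub>M k\<in>{..K}. borel)"

definition coord_law :: "(nat \<Rightarrow> (nat \<Rightarrow> real) \<Rightarrow> real) \<Rightarrow> nat \<Rightarrow> ((nat \<Rightarrow> real) \<times> (nat \<Rightarrow> real)) measure"
  where
  "coord_law G K = (\<Pi>\<^sub>M i\<in>{1..K}. uniform_measure lborel {0..1}) \<Otimes>\<^sub>M
     density (\<Pi>\<^sub>M k\<in>{..K}. lborel) (\<lambda>a. ennreal (G K a))"

text \<open>
  Functions carry the final \<open>\<sigma>\<close>-algebra of all the maps \<open>step_path T K\<close>: it is the largest one
  on which the law of the random path is defined, and a functional is measurable iff it is a
  measurable function of \<open>(u, a)\<close> for every number of jumps \<open>K\<close>. (The product \<open>\<sigma>\<close>-algebra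
  on all functions would not make \<open>f \<mapsto> \<integral> f\<close> measurable.)
\<close>

definition path_space :: "real \<Rightarrow> (real \<Rightarrow> real) measure" where
  "path_space T = sigma UNIV {B. \<forall>K. step_path T K -` B \<inter> space (coord_space K) \<in> sets (coord_space K)}"

text \<open>
  The law of the generalized compound Poisson process on \<open>[0, T]\<close> with intensity \<open>\<lambda>\<close>, where
  \<open>G K\<close> is the joint density of \<open>(a\<^sub>0, \<dots>, a\<^sub>K)\<close> given \<open>K\<close> jumps.
\<close>

definition gcpp_prior ::
    "real \<Rightarrow> real \<Rightarrow> (nat \<Rightarrow> (nat \<Rightarrow> real) \<Rightarrow> real) \<Rightarrow> (real \<Rightarrow> real) measure" where
  "gcpp_prior T lam G =
     measure_pmf (poisson_pmf lam) \<bind> (\<lambda>K. distr (coord_law G K) (path_space T) (step_path T K))"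

definition likelihood :: "real \<Rightarrow> nat \<Rightarrow> (real \<times> real) set \<Rightarrow> (real \<Rightarrow> real) \<Rightarrow> ennreal" where
  "likelihood T n N f =
     ennreal (exp (real n * (LINT x:{0..T}|lborel. f x))) *
     (if \<forall>(x, y) \<in> N. f x \<le> y then 1 else 0)"

definition posterior ::
    "real \<Rightarrow> nat \<Rightarrow> (real \<Rightarrow> real) measure \<Rightarrow> (real \<times> real) set \<Rightarrow> (real \<Rightarrow> real) set \<Rightarrow> ennreal" where
  "posterior T n Pr N B =
     (\<integral>\<^sup>+ f. likelihood T n N f * indicator B f \<partial>Pr) / (\<integral>\<^sup>+ f. likelihood T n N f \<partial>Pr)"

definition theta :: "(real \<Rightarrow> real) \<Rightarrow> real" where
  "theta f = (LINT x:{0..1}|lborel. f x)"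

definition f0 :: "real \<Rightarrow> real" where
  "f0 x = min (x + 1/2) (3/2)"

lemma sigma_algebra_path_space:
  "sigma_algebra UNIV {B. \<forall>K. step_path T K -` B \<inter> space (coord_space K) \<in> sets (coord_space K)}"
    (is "sigma_algebra UNIV ?S")
proof (rule sigma_algebra_iff2[THEN iffD2], intro conjI ballI allI impI)
  show "{} \<in> ?S" by simp
next
  fix B assume B: "B \<in> ?S"
  have "step_path T K -` (UNIV - B) \<inter> space (coord_space K) =
      space (coord_space K) - step_path T K -` B \<inter> space (coord_space K)" for K by auto
  with B show "UNIV - B \<in> ?S" by auto
next
  fix B :: "nat \<Rightarrow> _" assume B: "range B \<subseteq> ?S"
  have "step_path T K -` (\<Union>i. B i) \<inter> space (coord_space K) =
      (\<Union>i. step_path T K -` B i \<inter> space (coord_space K))" for K by auto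
  moreover have "(\<Union>i. step_path T K -` B i \<inter> space (coord_space K)) \<in> sets (coord_space K)" for K
    using B by (intro sets.countable_UN) auto
  ultimately show "(\<Union>i. B i) \<in> ?S" by simp
qed auto

lemma space_path_space [simp]: "space (path_space T) = UNIV"
  by (simp add: path_space_def)

lemma sets_path_space:
  "sets (path_space T) = {B. \<forall>K. step_path T K -` B \<inter> space (coord_space K) \<in> sets (coord_space K)}"
  unfolding path_space_def
  by (simp add: sigma_algebra.sigma_sets_eq[OF sigma_algebra_path_space])

lemma measurable_step_path: "step_path T K \<in> measurable (coord_space K) (path_space T)"
  by (auto simp: measurable_def sets_path_space)

lemma borel_measurable_path_space_iff:
  fixes h :: "(real \<Rightarrow> real) \<Rightarrow> 'b :: topological_space"
  shows "h \<in> borel_measurable (path_space T) \<longleftrightarrow>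
     (\<forall>K. (\<lambda>p. h (step_path T K p)) \<in> borel_measurable (coord_space K))"
proof
  assume "h \<in> borel_measurable (path_space T)"
  then show "\<forall>K. (\<lambda>p. h (step_path T K p)) \<in> borel_measurable (coord_space K)"
    using measurable_compose[OF measurable_step_path] by blast
next
  assume R: "\<forall>K. (\<lambda>p. h (step_path T K p)) \<in> borel_measurable (coord_space K)"
  show "h \<in> borel_measurable (path_space T)"
  proof (rule measurableI)
    fix A :: "'b set" assume "A \<in> sets borel"
    with R have "(\<lambda>p. h (step_path T K p)) -` A \<inter> space (coord_space K) \<in> sets (coord_space K)" for K
      by (blast intro: measurable_sets)
    then show "h -` A \<inter> space (path_space T) \<in> sets (path_space T)"
      by (simp add: sets_path_space vimage_def)
  qed simp
qed

lemma sets_coord_law: "sets (coord_law G K) = sets (coord_space K)"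
  unfolding coord_law_def coord_space_def
  by (intro sets_pair_measure_cong) (simp_all cong: sets_PiM_cong)

lemma nn_integral_gcpp_prior:
  assumes "\<And>K. prob_space (coord_law G K)"
    and h: "h \<in> borel_measurable (path_space T)"
  shows "(\<integral>\<^sup>+ f. h f \<partial>gcpp_prior T lam G) =
    (\<integral>\<^sup>+ K. (\<integral>\<^sup>+ p. h (step_path T K p) \<partial>coord_law G K) \<partial>measure_pmf (poisson_pmf lam))"
proof -
  have m: "step_path T K \<in> measurable (coord_law G K) (path_space T)" for K
    using measurable_step_path measurable_cong_sets[OF sets_coord_law refl] by blast
  have "(\<lambda>K. distr (coord_law G K) (path_space T) (step_path T K)) \<in>
      measurable (measure_pmf (poisson_pmf lam)) (subprob_algebra (path_space T))"
    by (auto simp: space_subprob_algebra intro!: prob_space_imp_subprob_space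
        prob_space.prob_space_distr assms m)
  with h show ?thesis
    unfolding gcpp_prior_def by (subst nn_integral_bind) (auto simp: nn_integral_distr m)
qed

lemma prob_space_coord_law_prod:
  fixes g :: "nat \<Rightarrow> real \<Rightarrow> real"
  assumes meas: "\<And>k. g k \<in> borel_measurable borel" and nonneg: "\<And>k x. g k x \<ge> 0"
    and int: "\<And>k. (\<integral>\<^sup>+ x. ennreal (g k x) \<partial>lborel) = 1"
  shows "prob_space (coord_law (\<lambda>K a. \<Prod>k\<le>K. g k (a k)) K)"
proof -
  interpret L: product_sigma_finite "\<lambda>_ :: nat. lborel :: real measure"
    by standard
  interpret U: prob_space "\<Pi>\<^sub>M i\<in>{1..K}. uniform_measure lborel {0..1 :: real}"
    by (intro prob_space_PiM prob_space_uniform_measure) auto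
  have "(\<integral>\<^sup>+ a. ennreal (\<Prod>k\<le>K. g k (a k)) \<partial>(\<Pi>\<^sub>M k\<in>{..K}. lborel)) =
      (\<integral>\<^sup>+ a. (\<Prod>k\<le>K. ennreal (g k (a k))) \<partial>(\<Pi>\<^sub>M k\<in>{..K}. lborel))"
    by (simp add: prod_ennreal nonneg)
  also have "\<dots> = (\<Prod>k\<le>K. \<integral>\<^sup>+ x. ennreal (g k x) \<partial>lborel)"
    using meas by (intro L.product_nn_integral_prod) auto
  finally have 1: "(\<integral>\<^sup>+ a. ennreal (\<Prod>k\<le>K. g k (a k)) \<partial>(\<Pi>\<^sub>M k\<in>{..K}. lborel)) = 1"
    by (simp add: int)
  have [measurable]: "g k \<in> borel_measurable borel" for k by (rule meas)
  have "(\<lambda>a. ennreal (\<Prod>k\<le>K. g k (a k))) \<in> borel_measurable (\<Pi>\<^sub>M k\<in>{..K}. lborel)"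
    by measurable
  then interpret A: prob_space "density (\<Pi>\<^sub>M k\<in>{..K}. lborel) (\<lambda>a. ennreal (\<Prod>k\<le>K. g k (a k)))"
    by (intro prob_spaceI) (simp add: emeasure_density 1 cong: nn_integral_cong)
  interpret UA: pair_prob_space "\<Pi>\<^sub>M i\<in>{1..K}. uniform_measure lborel {0..1 :: real}"
    "density (\<Pi>\<^sub>M k\<in>{..K}. lborel) (\<lambda>a. ennreal (\<Prod>k\<le>K. g k (a k)))" ..
  show ?thesis unfolding coord_law_def by (rule UA.prob_space_axioms)
qed

end

theory Submission
  imports Defs "HOL-Real_Asymp.Real_Asymp"
begin

text \<open>
  Write \<open>\<epsilon> = sqrt (ln n / n)\<close>. With probability tending to one every nondecreasing path below the
  points satisfies \<open>\<integral>\<^sub>0\<^sup>1 (f - f0)\<^sub>+ \<le> ct \<epsilon>\<close>, since this excess is only of order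
  \<open>n powr (-1/2)\<close>. If moreover \<open>\<theta>(f) \<ge> \<theta>(f0) - ct \<epsilon>\<close>, then the \<open>L\<^sup>1\<close> distance of \<open>f\<close> and \<open>f0\<close>
  on \<open>[0, 1]\<close> is at most \<open>3 ct \<epsilon>\<close>; as a step function with \<open>K\<close> jumps has distance at least
  \<open>1 / (8 (K + 1))\<close> from a line of slope one, this forces \<open>K + 1 \<ge> 1 / (24 ct \<epsilon>)\<close>. The Poisson
  prior on \<open>K\<close> gives such paths mass at most about \<open>exp (- sqrt (n ln n) / (96 ct))\<close>. On the other
  hand, paths below \<open>f0\<close> with about \<open>1 / \<epsilon>\<close> jumps contribute at least
  \<open>exp (n \<integral> f0 - C sqrt (n ln n))\<close> to the denominator of the posterior, with \<open>C\<close> independent of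
  \<open>ct\<close>, so a small \<open>ct\<close> suffices.
\<close>

section \<open>Step paths\<close>

lemma sorted_nth_le_iff:
  fixes xs :: "'a :: linorder list"
  assumes "sorted xs" "k < length xs"
  shows "xs ! k \<le> x \<longleftrightarrow> k < length (filter (\<lambda>y. y \<le> x) xs)"
  using assms
proof (induction xs arbitrary: k)
  case (Cons a xs)
  show ?case
  proof (cases "a \<le> x")
    case True
    then show ?thesis using Cons by (cases k) auto
  next
    case False
    then have "\<forall>y\<in>set (a # xs). \<not> y \<le> x" using Cons.prems by auto
    moreover from this have "\<not> (a # xs) ! k \<le> x" using Cons.prems nth_mem by blast
    ultimately show ?thesis by (auto simp: filter_empty_conv)
  qed
qed simp

text \<open>The \<open>k\<close>-th order statistic is at most \<open>x\<close> as soon as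
  \<open>k\<close> of the times are. This replaces sorting by a count, from which measurability of
  the jump times follows.\<close>

lemma jump_time_le_iff:
  assumes "1 \<le> k" "k \<le> K"
  shows "jump_time K u k \<le> x \<longleftrightarrow> k \<le> card {i \<in> {1..K}. u i \<le> x}"
proof -
  have "length (filter (\<lambda>y. y \<le> x) (sort (map u [1..<Suc K]))) =
      length (filter (\<lambda>i. u i \<le> x) [1..<Suc K])"
    by (simp add: filter_sort filter_map comp_def del: upt_Suc)
  also have "\<dots> = card {i \<in> {1..K}. u i \<le> x}"
    by (subst distinct_length_filter) (auto intro!: arg_cong[where f = card])
  finally have "length (filter (\<lambda>y. y \<le> x) (sort (map u [1..<Suc K]))) = card {i \<in> {1..K}. u i \<le> x}" .
  then show ?thesis
    using assms sorted_nth_le_iff[of "sort (map u [1..<Suc K])" "k - 1" x]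
    by (auto simp: jump_time_def simp del: upt_Suc)
qed

lemma jump_time_0 [simp]: "jump_time K u 0 = 0"
  by (simp add: jump_time_def)

lemma jump_time_in_image:
  assumes "1 \<le> k" "k \<le> K"
  shows "jump_time K u k \<in> u ` {1..K}"
proof -
  have "sort (map u [1..<Suc K]) ! (k - 1) \<in> set (sort (map u [1..<Suc K]))"
    using assms by (intro nth_mem) auto
  then show ?thesis using assms by (auto simp: jump_time_def)
qed

lemma jump_time_in_unit_interval:
  assumes "\<And>i. i \<in> {1..K} \<Longrightarrow> u i \<in> {0..1}" "k \<le> K"
  shows "jump_time K u k \<in> {0..1}"
  using assms jump_time_in_image[of k K u] by (cases "k = 0") auto

lemma jump_time_mono:
  assumes "\<And>i. i \<in> {1..K} \<Longrightarrow> u i \<in> {0..1}" "k \<le> l" "l \<le> K"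
  shows "jump_time K u k \<le> jump_time K u l"
proof (cases "k = 0")
  case True
  then show ?thesis using jump_time_in_unit_interval[of K u l] assms by auto
next
  case False
  then show ?thesis using assms
    by (auto simp: jump_time_def simp del: upt_Suc intro!: sorted_nth_mono)
qed

lemma jump_time_of_sorted:
  assumes "\<And>i j. 1 \<le> i \<Longrightarrow> i \<le> j \<Longrightarrow> j \<le> K \<Longrightarrow> u i \<le> u j" "1 \<le> k" "k \<le> K"
  shows "jump_time K u k = u k"
proof -
  have "sorted (map u [1..<Suc K])"
    using assms(1) by (auto simp: sorted_iff_nth_mono simp del: upt_Suc)
  then have "sort (map u [1..<Suc K]) = map u [1..<Suc K]"
    by (rule sorted_sort_id)
  then show ?thesis using assms(2,3) by (auto simp: jump_time_def simp del: upt_Suc)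
qed

lemma jump_time_measurable [measurable]:
  assumes "k \<le> K"
  shows "(\<lambda>u. jump_time K u k) \<in> borel_measurable (\<Pi>\<^sub>M i\<in>{1..K}. borel)"
proof (cases "k = 0")
  case False
  show ?thesis
  proof (rule borel_measurable_iff_le[THEN iffD2], rule allI)
    fix x :: real
    have "{u \<in> space (\<Pi>\<^sub>M i\<in>{1..K}. borel). jump_time K u k \<le> x} =
        {u \<in> space (\<Pi>\<^sub>M i\<in>{1..K}. borel). real k \<le> (\<Sum>i\<in>{1..K}. if u i \<le> x then 1 else 0)}"
      using False assms by (simp add: jump_time_le_iff sum.If_cases Int_def)
    also have "\<dots> \<in> sets (\<Pi>\<^sub>M i\<in>{1..K}. borel)"
      by measurable
    finally show "{u \<in> space (\<Pi>\<^sub>M i\<in>{1..K}. borel). jump_time K u k \<le> x} \<in> sets (\<Pi>\<^sub>M i\<in>{1..K}. borel)" .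
  qed
qed simp

section \<open>Values, monotonicity and integrals of step paths\<close>

text \<open>Jump times are nondecreasing, so those up to \<open>x\<close> have indices forming an
  initial segment \<open>{..j}\<close>. Times in the unit interval keep the artificial time 0 of
  index 0 first. The bound by the next jump time is what later shows that box paths do not lag far
  behind \<open>f0\<close>.\<close>

lemma step_path_eq_partial_sum:
  assumes u: "\<And>i. i \<in> {1..K} \<Longrightarrow> u i \<in> {0..1}" and x: "x \<in> {0..T}"
  obtains j where "j \<le> K" "jump_time K u j \<le> x" "j < K \<Longrightarrow> x < jump_time K u (Suc j)"
    "step_path T K (u, a) x = (\<Sum>k\<le>j. a k)"
proof -
  define S where "S = {k. k \<le> K \<and> jump_time K u k \<le> x}"
  have S: "finite S" "0 \<in> S" using x by (auto simp: S_def)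
  define j where "j = Max S"
  have j: "j \<in> S" unfolding j_def using S by (intro Max_in) auto
  have S_eq: "S = {..j}"
  proof
    show "S \<subseteq> {..j}" using S by (auto simp: j_def)
    show "{..j} \<subseteq> S"
      using j jump_time_mono[of K u _ j] u by (force simp: S_def intro: order_trans)
  qed
  have "step_path T K (u, a) x = (\<Sum>k\<in>{..K}. if k \<in> S then a k else 0)"
    unfolding step_path_def prod.case
    using x by (intro sum.cong) (auto simp: S_def indicator_def)
  also have "\<dots> = (\<Sum>k\<in>{..K} \<inter> S. a k)"
    by (simp add: sum.If_cases)
  also have "{..K} \<inter> S = S" by (auto simp: S_def)
  also note S_eq
  finally have "step_path T K (u, a) x = (\<Sum>k\<le>j. a k)" .
  moreover have "x < jump_time K u (Suc j)" if "j < K"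
  proof -
    have "Suc j \<notin> S" using S_eq by auto
    then show ?thesis using that by (auto simp: S_def)
  qed
  ultimately show thesis using that j by (auto simp: S_def)
qed

lemma step_path_mono:
  assumes u: "\<And>i. i \<in> {1..K} \<Longrightarrow> u i \<in> {0..1}" and a: "\<And>k. k \<in> {1..K} \<Longrightarrow> a k \<ge> 0"
    and "0 \<le> x" "x \<le> y" "y \<le> T"
  shows "step_path T K (u, a) x \<le> step_path T K (u, a) y"
  unfolding step_path_def prod.case
proof (rule sum_mono)
  fix k assume k: "k \<in> {..K}"
  \<comment> \<open>The starting value \<open>a 0\<close> may be negative, but its indicator equals
    1 at both points.\<close>
  show "a k * indicator {jump_time K u k..T} x \<le> a k * indicator {jump_time K u k..T} y"
    using assms a[of k] k by (cases "k = 0") (auto simp: indicator_def)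
qed

lemma step_path_constant_after_1:
  assumes u: "\<And>i. i \<in> {1..K} \<Longrightarrow> u i \<in> {0..1}" and "1 \<le> x" "x \<le> T"
  shows "step_path T K (u, a) x = (\<Sum>k\<le>K. a k)"
  using assms jump_time_in_unit_interval[of K u]
  by (force simp: step_path_def intro!: sum.cong)

lemma integrable_indicator_Icc:
  "set_integrable lborel {x..y :: real} (\<lambda>z. a * indicator {s..t} z :: real)"
proof -
  have "integrable lborel (indicator ({x..y} \<inter> {s..t}) :: real \<Rightarrow> real)"
    by (intro integrable_real_indicator) (auto simp: emeasure_lborel_Icc_eq)
  from integrable_mult_right[OF this, of a] show ?thesis
    unfolding set_integrable_def indicator_inter_arith by (simp add: mult_ac)
qed

lemma integrable_step_path: "set_integrable lborel {x..y :: real} (step_path T K p)"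
  using integrable_indicator_Icc[of x y]
  unfolding step_path_def case_prod_beta set_integrable_def scaleR_sum_right
  by (intro Bochner_Integration.integrable_sum) auto

text \<open>A closed formula in the jump times and heights; it makes the integral of a path a
  measurable functional on \<open>path_space\<close>.\<close>

lemma LINT_step_path:
  "(LINT z:{x..y}|lborel. step_path T K (u, a) z) =
    (\<Sum>k\<le>K. a k * max 0 (min T y - max (jump_time K u k) x))"
proof -
  have *: "{x..y} \<inter> {t..T} = {max t x..min T y}" for t by auto
  have **: "(LINT z:{x..y}|lborel. a k * indicator {t..T} z) = a k * max 0 (min T y - max t x)" for k t
  proof -
    have "(LINT z:{x..y}|lborel. a k * indicator {t..T} z) = a k * measure lborel {max t x..min T y}"
    proof -
      have "(LINT z:{x..y}|lborel. a k * indicator {t..T} z) = (LINT z|lborel. a k * indicator ({x..y} \<inter> {t..T}) z)"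
        unfolding set_lebesgue_integral_def indicator_inter_arith by (simp add: mult_ac)
      then show ?thesis by (simp only: *) simp
    qed
    also have "measure lborel {max t x..min T y} = max 0 (min T y - max t x)"
      by (cases "max t x \<le> min T y") auto
    finally show ?thesis .
  qed
  have "(LINT z:{x..y}|lborel. step_path T K (u, a) z) =
     (\<Sum>k\<le>K. LINT z:{x..y}|lborel. a k * indicator {jump_time K u k..T} z)"
    using integrable_indicator_Icc[of x y]
    unfolding step_path_def prod.case set_lebesgue_integral_def set_integrable_def scaleR_sum_right
    by (intro Bochner_Integration.integral_sum) auto
  then show ?thesis by (simp only: **)
qed

section \<open>Distance of a step path from a line of slope one\<close>

lemma step_path_finite_valued:
  assumes u: "\<And>i. i \<in> {1..K} \<Longrightarrow> u i \<in> {0..1}"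
  obtains V where "finite V" "card V \<le> Suc K" "step_path T K (u, a) ` {0..T} \<subseteq> V"
proof
  let ?V = "(\<lambda>j. \<Sum>k\<le>j. a k) ` {..K}"
  show "finite ?V" "card ?V \<le> Suc K"
    using card_image_le[of "{..K}"] by auto
  show "step_path T K (u, a) ` {0..T} \<subseteq> ?V"
  proof
    fix v assume "v \<in> step_path T K (u, a) ` {0..T}"
    then obtain x where "x \<in> {0..T}" "v = step_path T K (u, a) x" by auto
    moreover obtain j where "j \<le> K" "step_path T K (u, a) x = (\<Sum>k\<le>j. a k)"
      using step_path_eq_partial_sum[of K u x T a] u \<open>x \<in> {0..T}\<close> by metis
    ultimately show "v \<in> ?V" by auto
  qed
qed

text \<open>The points \<open>x\<close> with \<open>\<bar>v - (x + s)\<bar> < \<delta>\<close> for some \<open>v \<in> V\<close> have measure at most \<open>2 q \<delta>\<close>,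
  which is \<open>1/2\<close> for \<open>\<delta> = 1 / (4 q)\<close>.\<close>

lemma L1_dist_finite_valued:
  assumes V: "finite V" "card V \<le> q" "q \<ge> 1"
    and \<psi>: "set_integrable lborel {0..1} \<psi>"
    and bound: "\<And>x. x \<in> {0..1} \<Longrightarrow> \<exists>v\<in>V. \<bar>v - (x + s)\<bar> \<le> \<psi> x"
  shows "1 / (8 * real q) \<le> (LINT x:{0..1}|lborel. \<psi> x)"
proof -
  define \<delta> where "\<delta> = 1 / (4 * real q)"
  define W where "W = (\<Union>v\<in>V. {v - s - \<delta><..<v - s + \<delta>})"
  have [measurable]: "W \<in> sets borel" unfolding W_def using V by auto
  have \<delta>: "\<delta> > 0" using V by (simp add: \<delta>_def)
  have "emeasure lborel W \<le> (\<Sum>v\<in>V. emeasure lborel {v - s - \<delta><..<v - s + \<delta>})"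
    unfolding W_def using V by (intro emeasure_subadditive_finite) auto
  also have "\<dots> = ennreal (card V * (2 * \<delta>))"
    using \<delta> by (simp add: ennreal_mult'' ennreal_of_nat_eq_real_of_nat)
  also have "\<dots> \<le> ennreal (1/2)"
    using V by (intro ennreal_leI) (auto simp: \<delta>_def field_simps)
  finally have W: "emeasure lborel W \<le> ennreal (1/2)" .
  have W': "emeasure lborel ({0..1} \<inter> W) \<le> ennreal (1/2)"
    by (rule order_trans[OF emeasure_mono W]) auto
  have "measure lborel ({0..1} \<inter> W) \<le> 1/2"
    using W' unfolding measure_def by (intro enn2real_leI) auto
  moreover have "measure lborel ({0..1} - W) = measure lborel {0..1::real} - measure lborel ({0..1} \<inter> W)"
  proof -
    have "{0..1} - W = {0..1} - {0..1} \<inter> W" by auto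
    moreover have "measure lborel ({0..1} - {0..1} \<inter> W) = measure lborel {0..1::real} - measure lborel ({0..1} \<inter> W)"
      by (rule measure_Diff) auto
    ultimately show ?thesis by (simp only:)
  qed
  ultimately have 1: "measure lborel ({0..1} - W) \<ge> 1/2" by simp
  have int: "integrable lborel (indicator ({0..1} - W) :: real \<Rightarrow> real)"
  proof (rule integrable_real_indicator)
    have "emeasure lborel ({0..1} - W) \<le> emeasure lborel {0..1::real}"
      by (intro emeasure_mono) auto
    then show "emeasure lborel ({0..1} - W) < \<infinity>" by (simp add: le_less_trans)
  qed auto
  \<comment> \<open>Off \<open>W\<close> every value in \<open>V\<close> is at least
    \<open>\<delta>\<close> away from the line, so \<open>\<psi>\<close> is at least
    \<open>\<delta>\<close> on a set of measure at least 1/2.\<close>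
  have "1 / (8 * real q) = \<delta> * (1/2)" by (simp add: \<delta>_def)
  also have "\<dots> \<le> \<delta> * measure lborel ({0..1} - W)" using 1 \<delta> by (intro mult_left_mono) auto
  also have "\<dots> = (LINT x|lborel. \<delta> * indicator ({0..1} - W) x)"
    by simp
  also have "\<dots> \<le> (LINT x:{0..1}|lborel. \<psi> x)"
    unfolding set_lebesgue_integral_def
  proof (rule integral_mono)
    show "integrable lborel (\<lambda>x. \<delta> * indicator ({0..1} - W) x)" using int by simp
    show "integrable lborel (\<lambda>x. indicat_real {0..1} x *\<^sub>R \<psi> x)"
      using \<psi> by (simp add: set_integrable_def)
    show "\<delta> * indicator ({0..1} - W) x \<le> indicat_real {0..1} x *\<^sub>R \<psi> x" for x
    proof (cases "x \<in> {0..1}")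
      case True
      then obtain v where v: "v \<in> V" "\<bar>v - (x + s)\<bar> \<le> \<psi> x" using bound by blast
      show ?thesis
      proof (cases "x \<in> W")
        case False
        then have "\<not> (v - s - \<delta> < x \<and> x < v - s + \<delta>)" using v by (auto simp: W_def)
        then show ?thesis using v True False by auto
      qed (use True v in \<open>auto simp: abs_le_iff\<close>)
    qed auto
  qed
  finally show ?thesis .
qed

section \<open>Void probabilities\<close>

lemma pt_count_eq_0_iff: "pt_count N A = 0 \<longleftrightarrow> N \<inter> A = {}"
  by (simp add: pt_count_def emeasure_count_space_eq_0)

lemma
  assumes "is_poisson_process_law E \<mu> P"
  shows prob_space_poisson_process_law: "prob_space P"
    and space_poisson_process_law: "space P = locally_finite_configs E"
    and sets_void_event: "A \<in> sets borel \<Longrightarrow> {N \<in> space P. N \<inter> A = {}} \<in> sets P"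
    and prob_void_event: "A \<in> sets borel \<Longrightarrow> emeasure \<mu> A < \<infinity> \<Longrightarrow>
      measure P {N \<in> space P. N \<inter> A = {}} = exp (- measure \<mu> A)"
proof -
  from assms have sets: "sets P = sets (config_space E)" and "prob_space P"
    and void: "\<And>A k. A \<in> sets borel \<Longrightarrow> emeasure \<mu> A < \<infinity> \<Longrightarrow>
      measure P {N \<in> space P. pt_count N A = of_nat k} = measure \<mu> A ^ k / fact k * exp (- measure \<mu> A)"
    by (auto simp: is_poisson_process_law_def)
  then show "prob_space P" by simp
  have sub: "{{N \<in> locally_finite_configs E. pt_count N A = of_nat k} | A k. A \<in> sets borel} \<subseteq>
      Pow (locally_finite_configs E)" by auto
  show space: "space P = locally_finite_configs E"
    using sets_eq_imp_space_eq[OF sets] sub by (simp add: config_space_def)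
  show "{N \<in> space P. N \<inter> A = {}} \<in> sets P" if "A \<in> sets borel"
  proof -
    \<comment> \<open>Written with \<open>of_nat 0\<close>, the void event is visibly one of the
      generators of the sigma-algebra.\<close>
    have "{N \<in> locally_finite_configs E. pt_count N A = of_nat 0} \<in>
        {{N \<in> locally_finite_configs E. pt_count N A = of_nat k} | A k. A \<in> sets borel}"
      using that by blast
    then show ?thesis
      unfolding space sets config_space_def sets_measure_of[OF sub]
      by (auto simp: pt_count_eq_0_iff intro: sigma_sets.Basic)
  qed
  show "measure P {N \<in> space P. N \<inter> A = {}} = exp (- measure \<mu> A)"
    if "A \<in> sets borel" "emeasure \<mu> A < \<infinity>"
    using void[OF that, of 0] by (simp add: pt_count_eq_0_iff)
qed

text \<open>Only finitely many points lie in each ball of integer radius. Countability later turns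
  the constraint in the likelihood into a countable intersection of measurable events.\<close>

lemma countable_locally_finite_configs:
  assumes "N \<in> locally_finite_configs E"
  shows "countable N"
proof -
  have "N = (\<Union>k::nat. N \<inter> cball 0 (real k))"
    by (auto simp: real_arch_simple)
  moreover have "finite (N \<inter> cball 0 (real k))" for k
    using assms by (auto simp: locally_finite_configs_def)
  ultimately show ?thesis by (metis countable_UN countable_finite countableI_type)
qed

lemma f0_measurable [measurable]: "f0 \<in> borel_measurable borel"
  unfolding f0_def by measurable

lemma strip_epigraph_measurable:
  fixes f :: "real \<Rightarrow> real"
  assumes [measurable]: "f \<in> borel_measurable borel"
  shows "{(x, y). x \<in> {0..T} \<and> f x \<le> y} \<in> sets (borel \<Otimes>\<^sub>M borel)"
proof -
  have "{p \<in> space (borel \<Otimes>\<^sub>M borel). fst p \<in> {0..T} \<and> f (fst p) \<le> snd p} \<in> sets (borel \<Otimes>\<^sub>M borel)"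
    by measurable
  then show ?thesis by (simp add: space_pair_measure case_prod_unfold)
qed

lemma emeasure_boundary_intensity:
  assumes f: "f \<in> borel_measurable borel" and A: "A \<in> sets (borel \<Otimes>\<^sub>M borel)"
  shows "emeasure (boundary_intensity T n f) A =
    (\<integral>\<^sup>+ p. of_nat n * indicator {(x, y). x \<in> {0..T} \<and> f x \<le> y} p * indicator A p \<partial>(lborel \<Otimes>\<^sub>M lborel))"
proof -
  have "(\<lambda>p. of_nat n * indicator {(x, y). x \<in> {0..T} \<and> f x \<le> y} p :: ennreal) \<in> borel_measurable lborel"
  proof -
    have [measurable]: "{(x, y). x \<in> {0..T} \<and> f x \<le> y} \<in> sets borel"
      using strip_epigraph_measurable[OF f, of T] unfolding borel_prod .
    show ?thesis by measurable
  qed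
  then show ?thesis
    using A unfolding borel_prod lborel_prod boundary_intensity_def
    by (subst emeasure_density) simp_all
qed

text \<open>A rectangle above the graph lies inside the support of the intensity, so its intensity
  is \<open>n\<close> times its area.\<close>

lemma prob_rectangle_void:
  assumes P: "is_model_law T n f P" and [measurable]: "f \<in> borel_measurable borel"
    and ab: "0 \<le> a" "a \<le> b" "b \<le> T" and lu: "l \<le> u"
    and above: "\<And>x. x \<in> {a..b} \<Longrightarrow> f x \<le> l"
  shows "measure P {N \<in> space P. N \<inter> ({a..b} \<times> {l..u}) = {}} = exp (- (real n * (b - a) * (u - l)))"
proof -
  have "emeasure (boundary_intensity T n f) ({a..b} \<times> {l..u}) =
      (\<integral>\<^sup>+ p. of_nat n * indicator {(x, y). x \<in> {0..T} \<and> f x \<le> y} p *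
        indicator ({a..b} \<times> {l..u}) p \<partial>(lborel \<Otimes>\<^sub>M lborel))"
    by (rule emeasure_boundary_intensity) auto
  also have "\<dots> = (\<integral>\<^sup>+ p. of_nat n * indicator ({a..b} \<times> {l..u}) p \<partial>(lborel \<Otimes>\<^sub>M lborel))"
    using ab above by (intro nn_integral_cong) (force simp: indicator_def)
  also have "\<dots> = of_nat n * emeasure (lborel \<Otimes>\<^sub>M lborel) ({a..b} \<times> {l..u})"
    by (subst nn_integral_cmult_indicator) auto
  also have "emeasure (lborel \<Otimes>\<^sub>M lborel) ({a..b} \<times> {l..u}) = ennreal (b - a) * ennreal (u - l)"
    using ab lu by (subst lborel.emeasure_pair_measure_Times) auto
  also have "of_nat n * (ennreal (b - a) * ennreal (u - l)) = ennreal (real n * (b - a) * (u - l))"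
    using ab lu by (simp add: ennreal_mult ennreal_of_nat_eq_real_of_nat mult.assoc)
  finally have *: "emeasure (boundary_intensity T n f) ({a..b} \<times> {l..u}) = ennreal (real n * (b - a) * (u - l))" .
  have "{a..b} \<times> {l..u} \<in> sets (borel :: (real \<times> real) measure)"
    unfolding borel_prod[symmetric] by measurable
  then show ?thesis
    using P ab lu * unfolding is_model_law_def
    by (subst prob_void_event) (auto simp: measure_def)
qed

text \<open>The region strictly below the graph has intensity zero and is therefore void with
  probability \<open>exp 0 = 1\<close>.\<close>

lemma AE_points_above_boundary:
  assumes P: "is_model_law T n f P" and [measurable]: "f \<in> borel_measurable borel"
  shows "AE N in P. \<forall>(x, y)\<in>N. f x \<le> y"
proof -
  let ?A = "{(x, y). y < f x}"
  have "{p \<in> space (borel \<Otimes>\<^sub>M borel). snd p < f (fst p)} \<in> sets (borel \<Otimes>\<^sub>M borel)"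
    by measurable
  then have A [measurable]: "?A \<in> sets (borel \<Otimes>\<^sub>M borel)"
    by (simp add: space_pair_measure case_prod_unfold)
  have "emeasure (boundary_intensity T n f) ?A =
      (\<integral>\<^sup>+ p. of_nat n * indicator {(x, y). x \<in> {0..T} \<and> f x \<le> y} p * indicator ?A p \<partial>(lborel \<Otimes>\<^sub>M lborel))"
    by (rule emeasure_boundary_intensity) auto
  also have "\<dots> = (\<integral>\<^sup>+ (p :: real \<times> real). 0 \<partial>(lborel \<Otimes>\<^sub>M lborel))"
    by (intro nn_integral_cong) (auto simp: indicator_def not_less)
  finally have *: "emeasure (boundary_intensity T n f) ?A = 0" by simp
  interpret prob_space P using P by (auto simp: is_model_law_def prob_space_poisson_process_law)
  have "measure P {N \<in> space P. N \<inter> ?A = {}} = 1"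
    using P A * unfolding is_model_law_def borel_prod
    by (subst prob_void_event) (auto simp: measure_def)
  moreover have "{N \<in> space P. N \<inter> ?A = {}} \<in> events"
    using P A unfolding is_model_law_def borel_prod by (intro sets_void_event) auto
  ultimately have "AE N in P. N \<in> {N \<in> space P. N \<inter> ?A = {}}"
    by (intro AE_in_set_eq_1[THEN iffD2])
  then show ?thesis by eventually_elim (force simp: not_less)
qed

section \<open>Empty squares above the graph of \<open>f0\<close>\<close>

text \<open>
  If a nondecreasing path below the points exceeds \<open>f0\<close> by more than \<open>(i + 1) h\<close> somewhere on
  \<open>[j h, (j + 1) h]\<close>, then it passes above this square of side \<open>i h / 2\<close>, which therefore contains
  no points, although it lies above the graph of \<open>f0\<close>. So on that interval the excess is at most
  \<open>h (1 + void_count J j N)\<close> with \<open>h = 1 / J\<close>.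
\<close>

definition void_square :: "real \<Rightarrow> nat \<Rightarrow> nat \<Rightarrow> (real \<times> real) set" where
  "void_square h j i =
    {real (j + 1) * h..real (j + 1) * h + real i * h / 2} \<times>
    {1/2 + real (j + 1) * h + real i * h / 2..1/2 + real (j + 1 + i) * h}"

definition void_count :: "nat \<Rightarrow> nat \<Rightarrow> (real \<times> real) set \<Rightarrow> real" where
  "void_count J j N = real (card {i. i < J - j \<and> N \<inter> void_square (1 / real J) j i = {}})"

lemma void_square_borel [measurable]: "void_square h j i \<in> sets borel"
  unfolding void_square_def borel_prod[symmetric] by measurable

text \<open>The square has area \<open>i^2 / (4 J^2)\<close>, so \<open>4 J^2 <= n\<close> makes the
  expected number of its points at least \<open>i^2 >= i\<close>; then
  \<open>exp (-1) <= 1/2\<close> gives a geometric bound. The restriction on \<open>i\<close> keeps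
  the square over the unit interval, where \<open>f0\<close> has slope one.\<close>

lemma prob_void_square_le:
  assumes P: "is_model_law T n f0 P" and T: "T > 1" and J: "J \<ge> 1" "4 * J\<^sup>2 \<le> n"
    and ij: "j < J" "i < J - j"
  shows "measure P {N \<in> space P. N \<inter> void_square (1 / real J) j i = {}} \<le> (1/2) ^ i"
proof -
  let ?h = "1 / real J"
  have h: "?h > 0" using J by simp
  define a where "a = real (j + 1) * ?h"
  define w where "w = real i * ?h / 2"
  have aw: "a \<ge> 0" "w \<ge> 0" "real (j + 1 + i) * ?h = a + 2 * w"
    using J by (auto simp: a_def w_def add_divide_distrib)
  have "real (j + 1 + i) * ?h \<le> 1" using ij J by (simp add: field_simps)
  then have le1: "a + w \<le> 1" using aw by linarith
  have n: "4 * (real J)\<^sup>2 \<le> real n" using J(2) by (metis of_nat_le_iff of_nat_mult of_nat_numeral of_nat_power)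
  have "measure P {N \<in> space P. N \<inter> void_square ?h j i = {}} = exp (- (real n * (a + w - a) * (1/2 + (a + 2 * w) - (1/2 + a + w))))"
    unfolding void_square_def aw(3) unfolding a_def[symmetric] w_def[symmetric]
    using T le1 aw by (intro prob_rectangle_void[OF P]) (auto simp: f0_def)
  also have "\<dots> = exp (- (real n * (real i * ?h / 2) * (real i * ?h / 2)))"
    by (simp add: w_def)
  also have "\<dots> \<le> exp (- real i)"
  proof -
    have "real i \<le> (real i)\<^sup>2" by (cases i) (auto simp: power2_eq_square)
    also have "\<dots> = 4 * (real J)\<^sup>2 * ((real i * ?h / 2) * (real i * ?h / 2))"
      using J by (simp add: field_simps power2_eq_square)
    also have "\<dots> \<le> real n * ((real i * ?h / 2) * (real i * ?h / 2))"
      using n by (intro mult_right_mono) auto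
    finally show ?thesis by (simp add: mult_ac)
  qed
  also have "\<dots> = exp (-1) ^ i" by (simp add: exp_of_nat_mult[symmetric])
  also have "\<dots> \<le> (1/2) ^ i"
  proof (rule power_mono)
    show "exp (- 1) \<le> (1/2 :: real)" using exp_ge_add_one_self[of 1] by (simp add: exp_minus field_simps)
  qed auto
  finally show ?thesis .
qed

lemma void_count_eq_sum:
  "void_count J j N = (\<Sum>i<J - j. of_bool (N \<inter> void_square (1 / real J) j i = {}))"
  by (simp add: void_count_def of_bool_def sum.If_cases Int_def lessThan_def)

lemma sum_void_count_measurable:
  assumes "is_model_law T n f P"
  shows "(\<lambda>N. \<Sum>j<J. void_count J j N) \<in> borel_measurable P"
proof -
  have [measurable]: "Measurable.pred P (\<lambda>N. N \<inter> void_square h j i = {})" for h j i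
    using sets_void_event[OF assms[unfolded is_model_law_def] void_square_borel]
    by (simp add: pred_def)
  show ?thesis unfolding void_count_eq_sum by measurable
qed

text \<open>Markov's inequality: for each \<open>j\<close> the expected void count is at most the
  geometric series with sum 2, and expectations add up even though squares may overlap.\<close>

lemma prob_many_voids_le:
  assumes P: "is_model_law T n f0 P" and T: "T > 1" and J: "J \<ge> 1" "4 * J\<^sup>2 \<le> n" and s: "s > 0"
  shows "measure P {N \<in> space P. (\<Sum>j<J. void_count J j N) \<ge> s} \<le> 2 * real J / s"
proof -
  interpret prob_space P using P by (auto simp: is_model_law_def prob_space_poisson_process_law)
  let ?V = "\<lambda>j i. {N \<in> space P. N \<inter> void_square (1 / real J) j i = {}}"
  have V [measurable]: "?V j i \<in> events" for j i
    using P sets_void_event by (simp add: is_model_law_def)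
  have eq: "(\<Sum>j<J. void_count J j N) = (\<Sum>j<J. \<Sum>i<J - j. indicator (?V j i) N)" if "N \<in> space P" for N
    using that by (simp add: void_count_eq_sum indicator_def of_bool_def)
  have int: "integrable P (\<lambda>N. \<Sum>j<J. \<Sum>i<J - j. indicator (?V j i) N :: real)"
    by (intro Bochner_Integration.integrable_sum integrable_real_indicator) (auto simp: emeasure_eq_measure)
  have "measure P {N \<in> space P. (\<Sum>j<J. void_count J j N) \<ge> s} =
     measure P {N \<in> space P. (\<Sum>j<J. \<Sum>i<J - j. indicator (?V j i) N) \<ge> s}"
    by (intro arg_cong[where f = "measure P"]) (auto simp: eq)
  also have "\<dots> \<le> (LINT N|P. (\<Sum>j<J. \<Sum>i<J - j. indicator (?V j i) N)) / s"
    using int s by (intro integral_Markov_inequality_measure[where A = "{}"]) (auto intro!: AE_I2 sum_nonneg)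
  also have "(LINT N|P. (\<Sum>j<J. \<Sum>i<J - j. indicator (?V j i) N)) = (\<Sum>j<J. \<Sum>i<J - j. measure P (?V j i))"
    by (simp add: Bochner_Integration.integral_sum emeasure_eq_measure)
  also have "\<dots> \<le> (\<Sum>j<J. 2)"
  proof (intro sum_mono)
    fix j assume j: "j \<in> {..<J}"
    have "(\<Sum>i<J - j. measure P (?V j i)) \<le> (\<Sum>i<J - j. (1/2) ^ i)"
      using prob_void_square_le[OF P T J] j by (intro sum_mono) auto
    also have "\<dots> \<le> 2" by (simp add: sum_gp_strict)
    finally show "(\<Sum>i<J - j. measure P (?V j i)) \<le> 2" .
  qed
  finally show ?thesis using s by (simp add: divide_right_mono mult.commute)
qed

section \<open>Monotone paths below the points\<close>

lemma LINT_indicator_subinterval: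
  assumes "x \<le> s" "s \<le> t" "t \<le> y"
  shows "(LINT z:{x..y}|lborel. a * indicator {s..t} z) = a * (t - s :: real)"
proof -
  have "(LINT z:{x..y}|lborel. a * indicator {s..t} z) = (LINT z|lborel. a * indicator {s..t} z)"
    unfolding set_lebesgue_integral_def
    by (intro Bochner_Integration.integral_cong) (use assms in \<open>auto simp: indicator_def\<close>)
  then show ?thesis using assms by simp
qed

lemma integrable_f0: "set_integrable lborel {x..y} f0"
  unfolding f0_def by (intro borel_integrable_atLeastAtMost' continuous_intros)

text \<open>At least \<open>r - 1\<close> naturals \<open>i\<close> satisfy \<open>i + 1 < r\<close>
  when \<open>r >= 1\<close>. The hypothesis ensures that cutting off at \<open>M\<close> does not
  spoil this count.\<close>

lemma le_one_plus_card_less: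
  fixes r :: real
  assumes "r \<le> real M + 1"
  shows "r \<le> 1 + real (card {i. i < M \<and> real i + 1 < r})"
  using assms
proof (induction M)
  case (Suc M)
  show ?case
  proof (cases "r \<le> real M + 1")
    case True
    have "card {i. i < M \<and> real i + 1 < r} \<le> card {i. i < Suc M \<and> real i + 1 < r}"
      by (intro card_mono) auto
    then show ?thesis using Suc.IH[OF True] by linarith
  next
    case False
    then have "{i. i < Suc M \<and> real i + 1 < r} = {..M}" by auto
    then show ?thesis using Suc.prems by simp
  qed
qed simp

text \<open>A piecewise constant random majorant for the excess of a monotone path over
  \<open>f0\<close>. Neighbouring closed intervals share an endpoint, where both summands count;
  this respects the upper bound and leaves the integral unchanged.\<close>

definition excess_bound :: "nat \<Rightarrow> (real \<times> real) set \<Rightarrow> real \<Rightarrow> real" where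
  "excess_bound J N x =
    (\<Sum>j<J. (1 + void_count J j N) / real J * indicator {real j / real J..real (j + 1) / real J} x)"

lemma void_count_nonneg: "void_count J j N \<ge> 0"
  by (simp add: void_count_def)

lemma excess_bound_nonneg: "excess_bound J N x \<ge> 0"
  unfolding excess_bound_def
  by (intro sum_nonneg mult_nonneg_nonneg divide_nonneg_nonneg add_nonneg_nonneg void_count_nonneg) auto

text \<open>The majorant vanishes beyond 1, so the same integral serves both the unit interval and
  \<open>{0..T}\<close>.\<close>

lemma excess_bound_integral:
  assumes "J \<ge> 1" "y \<ge> 1"
  shows "set_integrable lborel {0..y} (excess_bound J N)"
    and "(LINT x:{0..y}|lborel. excess_bound J N x) = 1 / real J + (\<Sum>j<J. void_count J j N) / (real J)\<^sup>2"
proof -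
  have int: "set_integrable lborel {0..y}
      (\<lambda>x. (1 + void_count J j N) / real J * indicator {real j / real J..real (j + 1) / real J} x)" for j
    by (rule integrable_indicator_Icc)
  show "set_integrable lborel {0..y} (excess_bound J N)"
    unfolding excess_bound_def set_integrable_def scaleR_sum_right
    using int by (intro Bochner_Integration.integrable_sum) (simp add: set_integrable_def)
  have "(LINT x:{0..y}|lborel. excess_bound J N x) =
      (\<Sum>j<J. LINT x:{0..y}|lborel. (1 + void_count J j N) / real J * indicator {real j / real J..real (j + 1) / real J} x)"
    unfolding excess_bound_def set_lebesgue_integral_def scaleR_sum_right
    using int by (intro Bochner_Integration.integral_sum) (simp add: set_integrable_def)
  also have "\<dots> = (\<Sum>j<J. (1 + void_count J j N) / real J * (1 / real J))"
  proof (intro sum.cong refl)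
    fix j assume j: "j \<in> {..<J}"
    then have "real (j + 1) \<le> real J" by (subst of_nat_le_iff) auto
    then have "real (j + 1) / real J \<le> 1" using assms by simp
    then have "real (j + 1) / real J \<le> y" using assms by linarith
    then have "(LINT x:{0..y}|lborel. (1 + void_count J j N) / real J * indicator {real j / real J..real (j + 1) / real J} x)
        = (1 + void_count J j N) / real J * (real (j + 1) / real J - real j / real J)"
      by (intro LINT_indicator_subinterval) (auto simp: divide_right_mono)
    then show "(LINT x:{0..y}|lborel. (1 + void_count J j N) / real J * indicator {real j / real J..real (j + 1) / real J} x)
        = (1 + void_count J j N) / real J * (1 / real J)"
      by (simp add: diff_divide_distrib[symmetric])
  qed
  also have "\<dots> = 1 / real J + (\<Sum>j<J. void_count J j N) / (real J)\<^sup>2"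
    using assms by (simp add: sum.distrib power2_eq_square add_divide_distrib sum_divide_distrib)
  finally show "(LINT x:{0..y}|lborel. excess_bound J N x) = 1 / real J + (\<Sum>j<J. void_count J j N) / (real J)\<^sup>2" .
qed

text \<open>Measured in units of \<open>1 / J\<close>, an excess \<open>r\<close> makes every square
  with \<open>i + 1 < r\<close> void, so the void count controls \<open>r - 1\<close>. The low point
  provided by \<open>last\<close> lies to the right of \<open>x\<close> and caps \<open>f x\<close>;
  hence \<open>r <= J - j + 1\<close>, and the finitely many squares counted suffice.\<close>

lemma monotone_excess_le:
  assumes J: "J \<ge> 1" and T: "T \<ge> 1"
    and mono: "\<And>x y. 0 \<le> x \<Longrightarrow> x \<le> y \<Longrightarrow> y \<le> T \<Longrightarrow> f x \<le> f y"
    and below: "\<And>x y. (x, y) \<in> N \<Longrightarrow> f x \<le> y"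
    and last: "N \<inter> ({1..T} \<times> {3/2..3/2 + 1 / real J}) \<noteq> {}"
    and x: "x \<in> {0..1}"
  shows "f x - f0 x \<le> excess_bound J N x"
proof -
  \<comment> \<open>The minimum assigns \<open>x = 1\<close> to the last interval.\<close>
  define j where "j = min (nat \<lfloor>x * real J\<rfloor>) (J - 1)"
  have j: "j < J" "real j \<le> x * real J" "x * real J \<le> real j + 1"
  proof -
    show "j < J" using J by (auto simp: j_def)
    have "real (nat \<lfloor>x * real J\<rfloor>) \<le> x * real J" using x by simp
    moreover have "x * real J \<le> real (nat \<lfloor>x * real J\<rfloor>) + 1" using x by (simp add: of_nat_nat)
    moreover have "x * real J \<le> real J" using x J by simp
    ultimately show "real j \<le> x * real J" "x * real J \<le> real j + 1"
      using J by (auto simp: j_def min_def of_nat_diff)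
  qed
  define r where "r = (f x - f0 x) * real J"
  have f0x: "f0 x = x + 1/2" using x by (auto simp: f0_def)
  have "r \<le> real (J - j) + 1"
  proof -
    from last obtain X Y where XY: "(X, Y) \<in> N" "1 \<le> X" "X \<le> T" "Y \<le> 3/2 + 1 / real J" by auto
    have "f x \<le> f X" using XY x by (intro mono) auto
    also have "f X \<le> Y" using XY below by blast
    finally have "f x - f0 x \<le> 1 + 1 / real J - x" using XY f0x by linarith
    then have "r \<le> (1 + 1 / real J - x) * real J" unfolding r_def by (intro mult_right_mono) auto
    also have "\<dots> = real J + 1 - x * real J" using J by (simp add: field_simps)
    finally show ?thesis using j by (simp add: of_nat_diff)
  qed
  then have "r \<le> 1 + real (card {i. i < J - j \<and> real i + 1 < r})"
    by (rule le_one_plus_card_less)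
  also have "card {i. i < J - j \<and> real i + 1 < r} \<le> card {i. i < J - j \<and> N \<inter> void_square (1 / real J) j i = {}}"
  proof (intro card_mono subsetI)
    fix i assume "i \<in> {i. i < J - j \<and> real i + 1 < r}"
    then have i: "i < J - j" "real i + 1 < r" by auto
    have False if "(X, Y) \<in> N" "(X, Y) \<in> void_square (1 / real J) j i" for X Y
    proof -
      have XY: "(real j + 1) / real J \<le> X" "Y \<le> 1/2 + (real j + 1 + real i) / real J"
          "X \<le> real (j + 1) * (1 / real J) + real i * (1 / real J) / 2"
        using that by (auto simp: void_square_def add_ac)
      have "X \<le> (real (j + 1) + real i / 2) / real J" using XY(3) by (simp add: add_divide_distrib)
      then have "X * real J \<le> real (j + 1) + real i / 2" using J by (simp add: pos_le_divide_eq)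
      also have "real i / 2 \<le> real i" by simp
      also have "real (j + 1) + real i \<le> real J" using i by linarith
      finally have "X \<le> 1" using J by simp
      moreover have "x \<le> X"
      proof -
        have "real j + 1 \<le> X * real J" using XY(1) J by (simp add: pos_divide_le_eq)
        then have "x * real J \<le> X * real J" using j by linarith
        then show ?thesis using J by simp
      qed
      ultimately have "f x \<le> f X" using x T by (intro mono) auto
      also have "f X \<le> Y" using that below by blast
      finally have "(f x - 1/2) * real J \<le> (Y - 1/2) * real J" by (intro mult_right_mono) auto
      also have "\<dots> \<le> real j + 1 + real i" using XY(2) J by (simp add: field_simps)
      also have "\<dots> < x * real J + r" using j i by linarith
      also have "\<dots> = (f x - 1/2) * real J" by (simp add: r_def f0x field_simps)
      finally show False by simp
    qed
    then show "i \<in> {i. i < J - j \<and> N \<inter> void_square (1 / real J) j i = {}}"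
      using i by auto
  qed auto
  finally have "r \<le> 1 + void_count J j N" by (simp add: void_count_def)
  then have "f x - f0 x \<le> (1 + void_count J j N) / real J"
    using J by (simp add: r_def field_simps)
  also have "\<dots> = (1 + void_count J j N) / real J * indicator {real j / real J..real (j + 1) / real J} x"
    using j J by (simp add: indicator_def field_simps)
  also have "\<dots> \<le> excess_bound J N x"
    unfolding excess_bound_def using j
    by (intro member_le_sum[where f = "\<lambda>j. (1 + void_count J j N) / real J * indicator {real j / real J..real (j + 1) / real J} x"])
       (auto intro!: mult_nonneg_nonneg divide_nonneg_nonneg add_nonneg_nonneg void_count_nonneg)
  finally show ?thesis .
qed

text \<open>For the integral, the excess costs at most \<open>b\<close> on the unit interval; after
  time 1 the path is constant and capped by the low point, which costs at most
  \<open>b * (T - 1)\<close>. For the jumps, a path whose \<open>theta\<close> is not small is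
  within \<open>L1\<close> distance \<open>3 b\<close> of a line of slope one, while
  \<open>K + 1\<close> values force a distance of at least \<open>1 / (8 (K + 1))\<close>.\<close>

lemma path_below_points_bounds:
  fixes a :: "nat \<Rightarrow> real"
  assumes J: "J \<ge> 1" and T: "T > 1"
    and u: "\<And>i. i \<in> {1..K} \<Longrightarrow> u i \<in> {0..1}" and a: "\<And>k. k \<in> {1..K} \<Longrightarrow> a k \<ge> 0"
    and below: "\<And>x y. (x, y) \<in> N \<Longrightarrow> step_path T K (u, a) x \<le> y"
    and last: "N \<inter> ({1..T} \<times> {3/2..3/2 + 1 / real J}) \<noteq> {}"
    and voids: "1 / real J + (\<Sum>j<J. void_count J j N) / (real J)\<^sup>2 \<le> b"
  shows path_below_points_integral_le:
      "(LINT x:{0..T}|lborel. step_path T K (u, a) x) \<le> (LINT x:{0..T}|lborel. f0 x) + T * b"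
    and path_below_points_many_jumps:
      "theta f0 - b \<le> theta (step_path T K (u, a)) \<Longrightarrow> 1 \<le> 24 * b * real (K + 1)"
proof -
  define f where "f = step_path T K (u, a)"
  have excess: "f x - f0 x \<le> excess_bound J N x" if "x \<in> {0..1}" for x
    using step_path_mono[of K u a] u a that below last J T unfolding f_def
    by (intro monotone_excess_le) auto
  have "0 \<le> (\<Sum>j<J. void_count J j N) / (real J)\<^sup>2"
    by (intro divide_nonneg_nonneg sum_nonneg void_count_nonneg) auto
  then have Jb: "1 / real J \<le> b" using voids by linarith
  have int_f: "set_integrable lborel {x..y} f" for x y
    unfolding f_def by (rule integrable_step_path)
  note [intro] = excess_bound_integral(1) integrable_f0 integrable_indicator_Icc int_f
  have tail: "f x - f0 x \<le> 1 / real J" if "x \<in> {1..T}" for x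
  proof -
    from last obtain X Y where XY: "(X, Y) \<in> N" "1 \<le> X" "X \<le> T" "Y \<le> 3/2 + 1 / real J" by auto
    have "f x = f X"
      using step_path_constant_after_1[where u = u and K = K and a = a and T = T] u XY that
      unfolding f_def by (metis atLeastAtMost_iff)
    also have "f X \<le> Y" using XY below by (auto simp: f_def)
    finally show ?thesis using XY that by (auto simp: f0_def)
  qed
  have "(LINT x:{0..T}|lborel. f x) \<le> (LINT x:{0..T}|lborel. f0 x + (excess_bound J N x + 1 / real J * indicator {1..T} x))"
  proof (rule set_integral_mono)
    show "set_integrable lborel {0..T} (\<lambda>x. f0 x + (excess_bound J N x + 1 / real J * indicator {1..T} x))"
      using J T by (intro set_integral_add excess_bound_integral(1) integrable_f0 integrable_indicator_Icc) auto
    fix x assume x: "x \<in> {0..T}"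
    show "f x \<le> f0 x + (excess_bound J N x + 1 / real J * indicator {1..T} x)"
    proof (cases "x \<le> 1")
      case True
      then have "f x - f0 x \<le> excess_bound J N x" using excess x by auto
      moreover have "0 \<le> 1 / real J * indicator {1..T} x" by simp
      ultimately show ?thesis by linarith
    next
      case False
      then show ?thesis using tail[of x] x excess_bound_nonneg[of J N x] by simp
    qed
  qed auto
  also have "\<dots> = (LINT x:{0..T}|lborel. f0 x) + ((LINT x:{0..T}|lborel. excess_bound J N x) +
      (LINT x:{0..T}|lborel. 1 / real J * indicator {1..T} x))"
  proof -
    have e: "set_integrable lborel {0..T} (excess_bound J N)"
      using J T by (intro excess_bound_integral(1)) auto
    have i: "set_integrable lborel {0..T} (\<lambda>x. 1 / real J * indicator {1..T} x)"
      by (rule integrable_indicator_Icc)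
    show ?thesis
      by (simp only: set_integral_add(2)[OF integrable_f0 set_integral_add(1)[OF e i]] set_integral_add(2)[OF e i])
  qed
  also have "(LINT x:{0..T}|lborel. excess_bound J N x) \<le> b"
    using voids J T by (subst excess_bound_integral(2)) auto
  also have "(LINT x:{0..T}|lborel. 1 / real J * indicator {1..T} x) = 1 / real J * (T - 1)"
    using T by (intro LINT_indicator_subinterval) auto
  also have "\<dots> \<le> b * (T - 1)" using Jb T by (intro mult_right_mono) auto
  finally show "(LINT x:{0..T}|lborel. step_path T K (u, a) x) \<le> (LINT x:{0..T}|lborel. f0 x) + T * b"
    by (simp add: f_def algebra_simps)
  show "1 \<le> 24 * b * real (K + 1)" if th: "theta f0 - b \<le> theta (step_path T K (u, a))"
  proof -
    \<comment> \<open>As \<open>f - f0\<close> is bounded above by the nonnegative majorant, this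
      function dominates its absolute value. Being affine in \<open>f - f0\<close>, it has an
      integral expressible through \<open>theta\<close>.\<close>
    define \<psi> where "\<psi> x = 2 * excess_bound J N x - (f x - f0 x)" for x
    have int_\<psi>: "set_integrable lborel {0..1} \<psi>"
      unfolding \<psi>_def using J by (intro set_integral_diff set_integrable_mult_right) auto
    have "(LINT x:{0..1}|lborel. \<psi> x) = 2 * (LINT x:{0..1}|lborel. excess_bound J N x) - (theta f - theta f0)"
      unfolding \<psi>_def theta_def using J
      by (subst set_integral_diff, auto intro!: set_integral_diff set_integrable_mult_right)+
    also have "\<dots> \<le> 2 * b - (- b)"
      using voids J th by (subst excess_bound_integral(2)) (auto simp: f_def)
    finally have \<psi>_le: "(LINT x:{0..1}|lborel. \<psi> x) \<le> 3 * b" by simp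
    obtain V where V: "finite V" "card V \<le> Suc K" "f ` {0..T} \<subseteq> V"
      using step_path_finite_valued[of K u T a] u unfolding f_def by blast
    have "1 / (8 * real (Suc K)) \<le> (LINT x:{0..1}|lborel. \<psi> x)"
    proof (rule L1_dist_finite_valued[OF V(1,2) _ int_\<psi>, of "1/2"])
      fix x :: real assume x: "x \<in> {0..1}"
      then have "f x \<in> V" "f0 x = x + 1/2" using V(3) T by (auto simp: f0_def)
      moreover have "\<bar>f x - f0 x\<bar> \<le> \<psi> x"
        using excess[OF x] excess_bound_nonneg[of J N x] by (simp add: \<psi>_def abs_le_iff)
      ultimately show "\<exists>v\<in>V. \<bar>v - (x + 1/2)\<bar> \<le> \<psi> x" by auto
    qed simp
    with \<psi>_le have "1 / (8 * real (Suc K)) \<le> 3 * b" by linarith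
    then show ?thesis by (simp add: field_simps)
  qed
qed

section \<open>Prior and posterior mass\<close>

lemma poisson_pgf:
  assumes "lam > 0" "z \<ge> 0"
  shows "(\<integral>\<^sup>+ k. ennreal (z ^ k) \<partial>measure_pmf (poisson_pmf lam)) = ennreal (exp (lam * (z - 1)))"
proof -
  have "(\<lambda>k. (lam * z) ^ k / fact k) sums exp (lam * z)"
    using exp_converges[of "lam * z"] by (simp add: scaleR_conv_of_real field_simps)
  then have "(\<lambda>k. exp (- lam) * ((lam * z) ^ k / fact k)) sums (exp (- lam) * exp (lam * z))"
    by (rule sums_mult)
  then have sums: "(\<lambda>k. pmf (poisson_pmf lam) k * z ^ k) sums exp (lam * (z - 1))"
    using assms by (simp add: power_mult_distrib exp_add[symmetric] field_simps)
  have "(\<integral>\<^sup>+ k. ennreal (z ^ k) \<partial>measure_pmf (poisson_pmf lam)) =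
      (\<Sum>k. ennreal (pmf (poisson_pmf lam) k * z ^ k))"
    using assms by (simp add: nn_integral_measure_pmf nn_integral_count_space_nat ennreal_mult[symmetric])
  also have "\<dots> = ennreal (exp (lam * (z - 1)))"
    using assms sums by (intro suminf_ennreal_eq) auto
  finally show ?thesis .
qed

text \<open>Chernoff bound: the indicator of \<open>x <= k\<close> is at most
  \<open>z powr (k - x)\<close>. The parameter \<open>z\<close> stays free because it will grow as a
  power of \<open>n\<close>, which puts a factor \<open>ln n\<close> into the exponent.\<close>

lemma poisson_tail_le:
  assumes "lam > 0" "z \<ge> 1"
  shows "emeasure (measure_pmf (poisson_pmf lam)) {k. x \<le> real k} \<le> ennreal (exp (lam * (z - 1)) * z powr (- x))"
proof -
  have "emeasure (measure_pmf (poisson_pmf lam)) {k. x \<le> real k} =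
      (\<integral>\<^sup>+ k. indicator {k. x \<le> real k} k \<partial>measure_pmf (poisson_pmf lam))"
    by simp
  also have "\<dots> \<le> (\<integral>\<^sup>+ k. ennreal (z powr (- x)) * ennreal (z ^ k) \<partial>measure_pmf (poisson_pmf lam))"
  proof (intro nn_integral_mono)
    fix k :: nat
    have "1 \<le> z powr (- x) * z ^ k" if "x \<le> real k"
      using assms that ge_one_powr_ge_zero[of z "real k - x"]
      by (simp add: powr_realpow[symmetric] powr_add[symmetric])
    then show "indicator {k. x \<le> real k} k \<le> ennreal (z powr (- x)) * ennreal (z ^ k)"
      using assms by (auto simp: indicator_def ennreal_mult[symmetric])
  qed
  also have "\<dots> = ennreal (z powr (- x)) * ennreal (exp (lam * (z - 1)))"
    using assms by (simp add: nn_integral_cmult poisson_pgf)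
  finally show ?thesis by (simp add: ennreal_mult[symmetric] mult.commute)
qed

section \<open>Measurability of the likelihood and of \<open>theta\<close>; bounds for
  ratios\<close>

lemma
  assumes "k \<le> K"
  shows height_measurable: "(\<lambda>p. snd p k) \<in> borel_measurable (coord_space K)"
    and jump_time_fst_measurable: "(\<lambda>p. jump_time K (fst p) k) \<in> borel_measurable (coord_space K)"
  using assms unfolding coord_space_def
  by (auto intro!: measurable_compose[OF measurable_snd] measurable_compose[OF measurable_fst]
      measurable_component_singleton jump_time_measurable[simplified])

lemma step_path_at_measurable:
  "(\<lambda>p. step_path T K p x) \<in> borel_measurable (coord_space K)"
proof -
  note [measurable] = height_measurable jump_time_fst_measurable
  show ?thesis
    unfolding step_path_def case_prod_beta indicator_def atLeastAtMost_iff
    by measurable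
qed

lemma LINT_path_measurable:
  "(\<lambda>f. LINT x:{y..z}|lborel. f x) \<in> borel_measurable (path_space T)"
  unfolding borel_measurable_path_space_iff
proof
  fix K
  note [measurable] = height_measurable jump_time_fst_measurable
  have "(\<lambda>p. \<Sum>k\<le>K. snd p k * max 0 (min T z - max (jump_time K (fst p) k) y)) \<in> borel_measurable (coord_space K)"
    by measurable
  then show "(\<lambda>p. LINT x:{y..z}|lborel. step_path T K p x) \<in> borel_measurable (coord_space K)"
    using LINT_step_path[of y z T K "fst p" "snd p" for p] by simp
qed

text \<open>Evaluations and integrals are measurable on \<open>path_space\<close>, and lying below a
  countable set of points is a countable intersection of evaluation events.\<close>

lemma likelihood_measurable:
  assumes "countable N"
  shows "likelihood T n N \<in> borel_measurable (path_space T)"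
proof -
  note [measurable] = LINT_path_measurable
  have [measurable]: "(\<lambda>f. f x) \<in> borel_measurable (path_space T)" for x
    unfolding borel_measurable_path_space_iff using step_path_at_measurable by blast
  have "{f \<in> space (path_space T). \<forall>p\<in>N. f (fst p) \<le> snd p} \<in> sets (path_space T)"
    using assms by measurable
  then have [measurable]: "{f. \<forall>(x, y)\<in>N. f x \<le> y} \<in> sets (path_space T)"
    by (simp add: case_prod_unfold)
  have "(\<lambda>f. ennreal (exp (real n * (LINT x:{0..T}|lborel. f x))) * indicator {f. \<forall>(x, y)\<in>N. f x \<le> y} f)
      \<in> borel_measurable (path_space T)"
    by measurable
  then show ?thesis
    by (simp add: likelihood_def[abs_def] indicator_def of_bool_def)
qed

lemma theta_event_measurable: "{f. theta f \<ge> t} \<in> sets (path_space T)"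
proof -
  note [measurable] = LINT_path_measurable[of 0 1]
  have "{f \<in> space (path_space T). theta f \<ge> t} \<in> sets (path_space T)"
    unfolding theta_def by measurable
  then show ?thesis by simp
qed

lemma ennreal_inverse_antimono:
  fixes x y :: ennreal
  assumes "x \<le> y"
  shows "inverse y \<le> inverse x"
  using assms ereal_inverse_antimono[of "enn2ereal x" "enn2ereal y"]
  by (simp add: less_eq_ennreal.rep_eq inverse_ennreal.rep_eq)

lemma ennreal_divide_le_divide:
  assumes "x \<le> ennreal p" "ennreal q \<le> y" "p \<ge> 0" "q > 0"
  shows "x / y \<le> ennreal (p / q)"
proof -
  have "x / y \<le> ennreal p / ennreal q"
    unfolding divide_ennreal_def using assms(1,2) by (intro mult_mono ennreal_inverse_antimono) auto
  then show ?thesis using assms(3,4) by (simp add: divide_ennreal)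
qed

text \<open>The numerator is at most the denominator. The conventions \<open>0 / 0 = 0\<close> and
  \<open>x / top = 0\<close> in \<open>ennreal\<close> cover the degenerate denominators.\<close>

lemma posterior_le_1: "posterior T n Pr N B \<le> 1"
proof -
  have "(\<integral>\<^sup>+ f. likelihood T n N f * indicator B f \<partial>Pr) \<le> (\<integral>\<^sup>+ f. likelihood T n N f \<partial>Pr)"
    by (intro nn_integral_mono) (auto simp: indicator_def)
  then show ?thesis
    unfolding posterior_def
    by (metis divide_right_mono_ennreal ennreal_divide_self ennreal_divide_top ennreal_zero_divide
        le_zero_eq order.trans order_top_class.top_greatest top.not_eq_extremum zero_le zero_le_one)
qed

section \<open>The prior with product densities\<close>

locale jump_prior =
  fixes lam c \<gamma> :: real and g :: "nat \<Rightarrow> real \<Rightarrow> real"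
  assumes lam: "lam > 0"
    and g_meas [measurable]: "\<And>k. g k \<in> borel_measurable borel"
    and g_nonneg: "\<And>k x. g k x \<ge> 0"
    and g_int: "\<And>k. (\<integral>\<^sup>+ x. ennreal (g k x) \<partial>lborel) = 1"
    and c: "c > 0" and \<gamma>: "\<gamma> \<ge> 0"
    and g_lower: "\<And>k x. x \<in> {0..1} \<Longrightarrow> g k x \<ge> c * x powr \<gamma>"
    and g_supp: "\<And>k x. k \<ge> 1 \<Longrightarrow> x < 0 \<Longrightarrow> g k x = 0"
begin

abbreviation "joint_density \<equiv> (\<lambda>K a. \<Prod>k\<le>K. g k (a k))"

abbreviation "prior T \<equiv> gcpp_prior T lam joint_density"

abbreviation "time_law K \<equiv> \<Pi>\<^sub>M i\<in>{1..K :: nat}. uniform_measure lborel {0..1 :: real}"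

abbreviation "height_law K \<equiv> density (\<Pi>\<^sub>M k\<in>{..K}. lborel) (\<lambda>a. ennreal (joint_density K a))"

lemma prob_space_coord_law: "prob_space (coord_law joint_density K)"
  using prob_space_coord_law_prod g_meas g_nonneg g_int by blast

lemma prob_space_time_law: "prob_space (time_law K)"
  by (intro prob_space_PiM prob_space_uniform_measure) auto

lemma joint_density_measurable:
  "(\<lambda>a. ennreal (joint_density K a)) \<in> borel_measurable (\<Pi>\<^sub>M k\<in>{..K}. lborel)"
  by measurable

lemma emeasure_height_law_box:
  assumes I [measurable]: "\<And>k. I k \<in> sets borel"
  shows "emeasure (height_law K) (PiE {..K} I) = (\<Prod>k\<le>K. \<integral>\<^sup>+ x. ennreal (g k x) * indicator (I k) x \<partial>lborel)"
proof -
  interpret L: product_sigma_finite "\<lambda>_ :: nat. lborel :: real measure"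
    by standard
  have box: "PiE {..K} I \<in> sets (\<Pi>\<^sub>M k\<in>{..K}. lborel)"
    by (intro sets_PiM_I_finite) auto
  have "emeasure (height_law K) (PiE {..K} I) =
      (\<integral>\<^sup>+ a. ennreal (joint_density K a) * indicator (PiE {..K} I) a \<partial>(\<Pi>\<^sub>M k\<in>{..K}. lborel))"
    using joint_density_measurable box by (rule emeasure_density)
  also have "\<dots> = (\<integral>\<^sup>+ a. (\<Prod>k\<le>K. ennreal (g k (a k)) * indicator (I k) (a k)) \<partial>(\<Pi>\<^sub>M k\<in>{..K}. lborel))"
  proof (intro nn_integral_cong)
    fix a :: "nat \<Rightarrow> real" assume a: "a \<in> space (\<Pi>\<^sub>M k\<in>{..K}. lborel)"
    show "ennreal (joint_density K a) * indicator (PiE {..K} I) a = (\<Prod>k\<le>K. ennreal (g k (a k)) * indicator (I k) (a k))"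
    proof (cases "a \<in> PiE {..K} I")
      case True
      then have "(\<Prod>k\<le>K. ennreal (g k (a k)) * indicator (I k) (a k)) = (\<Prod>k\<le>K. ennreal (g k (a k)))"
        by (intro prod.cong refl) (metis PiE_mem indicator_simps(1) mult.right_neutral)
      then show ?thesis using True g_nonneg by (simp add: prod_ennreal)
    next
      case False
      then obtain k where k: "k \<le> K" "a k \<notin> I k"
        using a by (auto simp: space_PiM PiE_iff)
      then have "(\<Prod>k\<le>K. ennreal (g k (a k)) * indicator (I k) (a k)) = 0"
        by (intro prod_zero) (auto intro!: bexI[of _ k])
      then show ?thesis using False by simp
    qed
  qed
  also have "\<dots> = (\<Prod>k\<le>K. \<integral>\<^sup>+ x. ennreal (g k x) * indicator (I k) x \<partial>lborel)"
    by (intro L.product_nn_integral_prod) auto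
  finally show ?thesis .
qed

lemma prob_space_height_law: "prob_space (height_law K)"
  using emeasure_height_law_box[of "\<lambda>_. UNIV" K] g_int
  by (intro prob_spaceI) (simp add: space_PiM)

text \<open>The support condition on the jump densities enters here: prior paths are almost surely
  nondecreasing, as the deterministic bounds demand.\<close>

lemma AE_coord_law_good:
  "AE p in coord_law joint_density K.
    (\<forall>i\<in>{1..K}. fst p i \<in> {0..1}) \<and> (\<forall>k\<in>{1..K}. snd p k \<ge> 0)"
proof -
  interpret U: prob_space "time_law K" by (rule prob_space_time_law)
  have "AE u in time_law K. u i \<in> {0..1}" if "i \<in> {1..K}" for i
    using that by (intro AE_PiM_component AE_uniform_measureI prob_space_uniform_measure) auto
  then have u: "AE u in time_law K. \<forall>i\<in>{1..K}. u i \<in> {0..1}"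
    by (intro AE_finite_allI) auto
  have a: "AE a in height_law K. \<forall>k\<in>{1..K}. a k \<ge> 0"
    unfolding AE_density[OF joint_density_measurable]
  proof (rule AE_I2, intro impI ballI)
    fix a k assume *: "ennreal (joint_density K a) > 0" "k \<in> {1..K}"
    then have "g k (a k) \<noteq> 0" using prod_zero[of "{..K}" "\<lambda>k. g k (a k)"] by fastforce
    then show "a k \<ge> 0" using g_supp[of k "a k"] * by force
  qed
  interpret A: prob_space "height_law K" by (rule prob_space_height_law)
  interpret UA: pair_prob_space "time_law K" "height_law K" ..
  show ?thesis
    unfolding coord_law_def
  proof (rule UA.AE_pair_measure)
    show "AE u in time_law K. AE a in height_law K.
        (\<forall>i\<in>{1..K}. fst (u, a) i \<in> {0..1}) \<and> (\<forall>k\<in>{1..K}. snd (u, a) k \<ge> 0)"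
      using u
    proof eventually_elim
      case (elim u)
      then show ?case using a by simp
    qed
    show "{p \<in> space (time_law K \<Otimes>\<^sub>M height_law K).
        (\<forall>i\<in>{1..K}. fst p i \<in> {0..1}) \<and> (\<forall>k\<in>{1..K}. snd p k \<ge> 0)} \<in> sets (time_law K \<Otimes>\<^sub>M height_law K)"
      by measurable
  qed
qed


section \<open>Upper bound for the posterior numerator\<close>

text \<open>For almost every path the integrand is at most the exponential of the capped integral,
  and it vanishes unless the path has at least \<open>1 / (24 b) - 1\<close> jumps. What remains is
  a Poisson tail.\<close>

lemma numerator_le:
  assumes T: "T > 1" and J: "J \<ge> 1" and b: "b > 0" and z: "z \<ge> 1"
    and N: "countable N"
    and last: "N \<inter> ({1..T} \<times> {3/2..3/2 + 1 / real J}) \<noteq> {}"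
    and voids: "1 / real J + (\<Sum>j<J. void_count J j N) / (real J)\<^sup>2 \<le> b"
  shows "(\<integral>\<^sup>+ f. likelihood T n N f * indicator {f. theta f \<ge> theta f0 - b} f \<partial>prior T) \<le>
    ennreal (exp (real n * ((LINT x:{0..T}|lborel. f0 x) + T * b)) *
      (exp (lam * (z - 1)) * z powr (1 - 1 / (24 * b))))"
proof -
  let ?B = "{f. theta f \<ge> theta f0 - b}"
  let ?E = "exp (real n * ((LINT x:{0..T}|lborel. f0 x) + T * b))"
  let ?q = "1 / (24 * b) - 1"
  note [measurable] = likelihood_measurable[OF N] theta_event_measurable
  have "(\<integral>\<^sup>+ f. likelihood T n N f * indicator ?B f \<partial>prior T) =
     (\<integral>\<^sup>+ K. (\<integral>\<^sup>+ p. likelihood T n N (step_path T K p) * indicator ?B (step_path T K p)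
        \<partial>coord_law joint_density K) \<partial>measure_pmf (poisson_pmf lam))"
    using prob_space_coord_law by (intro nn_integral_gcpp_prior) measurable
  also have "\<dots> \<le> (\<integral>\<^sup>+ K. ennreal ?E * indicator {K. ?q \<le> real K} K \<partial>measure_pmf (poisson_pmf lam))"
  proof (intro nn_integral_mono)
    fix K
    interpret C: prob_space "coord_law joint_density K" by (rule prob_space_coord_law)
    have "(\<integral>\<^sup>+ p. likelihood T n N (step_path T K p) * indicator ?B (step_path T K p) \<partial>coord_law joint_density K) \<le>
        (\<integral>\<^sup>+ p. ennreal ?E * indicator {K. ?q \<le> real K} K \<partial>coord_law joint_density K)"
    proof (intro nn_integral_mono_AE)
      show "AE p in coord_law joint_density K. likelihood T n N (step_path T K p) * indicator ?B (step_path T K p)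
          \<le> ennreal ?E * indicator {K. ?q \<le> real K} K"
        using AE_coord_law_good[of K]
      proof eventually_elim
        case (elim p)
        obtain u a where p: "p = (u, a)" by (cases p)
        show ?case
        proof (cases "(\<forall>(x, y)\<in>N. step_path T K p x \<le> y) \<and> step_path T K p \<in> ?B")
          case True
          then have below: "\<And>x y. (x, y) \<in> N \<Longrightarrow> step_path T K (u, a) x \<le> y"
            and th: "theta f0 - b \<le> theta (step_path T K (u, a))" by (auto simp: p)
          have good: "\<And>i. i \<in> {1..K} \<Longrightarrow> u i \<in> {0..1}" "\<And>k. k \<in> {1..K} \<Longrightarrow> a k \<ge> 0"
            using elim by (auto simp: p)
          have "(LINT x:{0..T}|lborel. step_path T K p x) \<le> (LINT x:{0..T}|lborel. f0 x) + T * b"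
            using path_below_points_integral_le[OF J T good below last voids] by (simp add: p)
          then have "likelihood T n N (step_path T K p) \<le> ennreal ?E"
            by (auto simp: likelihood_def intro!: ennreal_leI mult_left_mono)
          moreover have "1 \<le> 24 * b * real (K + 1)"
            using path_below_points_many_jumps[OF J T good below last voids th] .
          then have "?q \<le> real K" using b by (simp add: field_simps)
          ultimately show ?thesis by (simp add: indicator_def)
        qed (auto simp: likelihood_def)
      qed
    qed
    then show "(\<integral>\<^sup>+ p. likelihood T n N (step_path T K p) * indicator ?B (step_path T K p) \<partial>coord_law joint_density K)
        \<le> ennreal ?E * indicator {K. ?q \<le> real K} K"
      by (simp add: C.emeasure_space_1)
  qed
  also have "\<dots> = ennreal ?E * emeasure (measure_pmf (poisson_pmf lam)) {K. ?q \<le> real K}"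
    by (simp add: nn_integral_cmult)
  also have "\<dots> \<le> ennreal ?E * ennreal (exp (lam * (z - 1)) * z powr (- ?q))"
    by (intro mult_left_mono poisson_tail_le lam z) auto
  finally show ?thesis by (simp add: ennreal_mult[symmetric])
qed

section \<open>Lower bound for the posterior denominator\<close>

text \<open>The time windows are disjoint and increasing, so no reordering occurs; the windows are placed
  such that the paths stay between \<open>f0 - 3 / m\<close> and \<open>f0\<close>.\<close>

definition path_box :: "nat \<Rightarrow> ((nat \<Rightarrow> real) \<times> (nat \<Rightarrow> real)) set" where
  "path_box m =
    PiE {1..m} (\<lambda>i. {(real i - 1/2) / real m..real i / real m}) \<times>
    PiE {..m} (\<lambda>k. if k = 0 then {1/2 - 1 / real m..1/2 - 1 / real m + 1 / (real m)\<^sup>2}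
      else {1 / real m - 1 / (real m)\<^sup>2..1 / real m})"

text \<open>Jump \<open>j\<close> comes no earlier than \<open>(j - 1/2) / m\<close>, and the
  starting value is at least \<open>1 / (2 m)\<close> below 1/2, so the path stays below
  \<open>f0\<close>. The loss of \<open>3 / m\<close> has three parts of at most
  \<open>1 / m\<close> each: the low start, the deficits \<open>1 / m^2\<close> of up to
  \<open>m\<close> jumps, and the wait for the next jump.\<close>

lemma path_box_near_f0:
  assumes m: "m \<ge> 3" and p: "p \<in> path_box m" and x: "x \<in> {0..T}"
  shows "step_path T m p x \<le> f0 x" "f0 x - 3 / real m \<le> step_path T m p x"
proof -
  obtain u a where ua: "p = (u, a)" by (cases p)
  define \<epsilon> where "\<epsilon> = 1 / (real m)\<^sup>2"
  have m0: "real m > 0" using m by simp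
  have \<epsilon>: "real m * \<epsilon> = 1 / real m" "\<epsilon> \<ge> 0" "\<epsilon> \<le> 1 / (2 * real m)"
    using m by (auto simp: \<epsilon>_def power2_eq_square field_simps)
  have u: "(real i - 1/2) / real m \<le> u i" "u i \<le> real i / real m" if "i \<in> {1..m}" for i
    using p that by (auto simp: path_box_def ua PiE_iff)
  have heights: "a k \<in> (if k = 0 then {1/2 - 1 / real m..1/2 - 1 / real m + \<epsilon>} else {1 / real m - \<epsilon>..1 / real m})"
    if "k \<le> m" for k
  proof -
    from p have "a \<in> PiE {..m} (\<lambda>k. if k = 0 then {1/2 - 1 / real m..1/2 - 1 / real m + \<epsilon>}
        else {1 / real m - \<epsilon>..1 / real m})"
      unfolding path_box_def ua \<epsilon>_def by blast
    from PiE_mem[OF this, of k] that show ?thesis by simp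
  qed
  have a0: "1/2 - 1 / real m \<le> a 0" "a 0 \<le> 1/2 - 1 / real m + \<epsilon>"
    using heights[of 0] by auto
  have a: "1 / real m - \<epsilon> \<le> a k" "a k \<le> 1 / real m" if "k \<in> {1..m}" for k
    using heights[of k] that by auto
  have unit: "u i \<in> {0..1}" if i: "i \<in> {1..m}" for i
  proof -
    have "0 \<le> (real i - 1/2) / real m" using i by auto
    moreover have "real i / real m \<le> 1" using i by simp
    ultimately show ?thesis using u[OF i] by auto
  qed
  have sorted: "u i \<le> u k" if ik: "1 \<le> i" "i \<le> k" "k \<le> m" for i k
  proof (cases "i = k")
    case False
    then have "real i \<le> real k - 1/2" using ik by linarith
    then have "real i / real m \<le> (real k - 1/2) / real m" by (rule divide_right_mono) simp
    then show ?thesis using u[of i] u[of k] ik by fastforce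
  qed simp
  have jt: "jump_time m u k = u k" if "k \<in> {1..m}" for k
    using that sorted by (intro jump_time_of_sorted) auto
  obtain j where j: "j \<le> m" "jump_time m u j \<le> x" "j < m \<Longrightarrow> x < jump_time m u (Suc j)"
      "step_path T m (u, a) x = (\<Sum>k\<le>j. a k)"
    using step_path_eq_partial_sum[of m u x T a] unit x by metis
  have sum_split: "(\<Sum>k\<le>j. a k) = a 0 + (\<Sum>k\<in>{1..j}. a k)"
    by (simp add: atMost_atLeast0 sum.atLeast_Suc_atMost)
  have "(\<Sum>k\<in>{1..j}. a k) \<le> (\<Sum>k\<in>{1..j}. 1 / real m)"
    using a j by (intro sum_mono) auto
  moreover have half: "1 / (2 * real m) = 1 / real m / 2" "2 / real m = 2 * (1 / real m)" by auto
  moreover have "(\<Sum>k\<in>{1..j}. 1 / real m) = real j / real m" by simp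
  ultimately have up: "(\<Sum>k\<le>j. a k) \<le> 1/2 - 1 / (2 * real m) + real j / real m"
    using sum_split a0 \<epsilon>(3) by linarith
  have "(\<Sum>k\<in>{1..j}. 1 / real m - \<epsilon>) \<le> (\<Sum>k\<in>{1..j}. a k)"
    using a j by (intro sum_mono) auto
  then have "real j / real m - real j * \<epsilon> \<le> (\<Sum>k\<in>{1..j}. a k)"
    by (simp add: algebra_simps)
  moreover have "real j * \<epsilon> \<le> real m * \<epsilon>" using j \<epsilon> by (intro mult_right_mono) auto
  ultimately have low: "1/2 - 2 / real m + real j / real m \<le> (\<Sum>k\<le>j. a k)"
    using sum_split a0 \<epsilon>(1) half(2) by linarith
  have "(real j - 1/2) / real m \<le> x"
  proof (cases "j = 0")
    case True
    have "(real j - 1/2) / real m \<le> 0" using True by simp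
    then show ?thesis using x by simp
  next
    case False
    then show ?thesis using j u[of j] jt[of j] by simp
  qed
  moreover have "real j / real m \<le> 1" using j m by simp
  moreover have "0 \<le> 1 / (2 * real m)" by simp
  ultimately have "(\<Sum>k\<le>j. a k) \<le> x + 1/2" "(\<Sum>k\<le>j. a k) \<le> 3/2"
    using up half(1) unfolding diff_divide_distrib by linarith+
  then show "step_path T m p x \<le> f0 x"
    by (simp add: f0_def ua j(4))
  have "f0 x \<le> 1/2 + real (Suc j) / real m"
  proof (cases "j < m")
    case True
    then have "x \<le> real (Suc j) / real m" using j(3) jt[of "Suc j"] u[of "Suc j"] by simp
    then show ?thesis by (simp add: f0_def)
  next
    case False
    then have "real (Suc j) / real m = 1 + 1 / real m" using j m by (simp add: add_divide_distrib)
    moreover have "f0 x \<le> 3/2" unfolding f0_def by (rule min.cobounded2)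
    moreover have "0 \<le> 1 / real m" by simp
    ultimately show ?thesis by linarith
  qed
  then show "f0 x - 3 / real m \<le> step_path T m p x"
    using low by (simp add: ua j(4) add_divide_distrib)
qed

lemma path_box_sets: "path_box m \<in> sets (coord_law joint_density m)"
  unfolding path_box_def coord_law_def
  by (intro pair_measureI) (auto intro!: sets_PiM_I_finite)

text \<open>A lower bound for the mass of \<open>path_box m\<close> given \<open>m\<close> jumps:
  \<open>m\<close> time windows of length \<open>1 / (2 m)\<close>, and \<open>m + 1\<close> height
  intervals of length \<open>1 / m^2\<close> on which each density is at least
  \<open>c * (1 / (2 m)) powr \<gamma>\<close>.\<close>

definition box_mass :: "nat \<Rightarrow> real" where
  "box_mass m = (1 / (2 * real m)) ^ m * (c * (1 / (2 * real m)) powr \<gamma> / (real m)\<^sup>2) ^ (m + 1)"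

lemma emeasure_path_box_ge:
  assumes m: "m \<ge> 3"
  shows "ennreal (box_mass m) \<le> emeasure (coord_law joint_density m) (path_box m)"
proof -
  let ?I = "\<lambda>i. {(real i - 1/2) / real m..real i / real m}"
  let ?A = "\<lambda>k. if k = 0 then {1/2 - 1 / real m..1/2 - 1 / real m + 1 / (real m)\<^sup>2}
      else {1 / real m - 1 / (real m)\<^sup>2..1 / real m} :: real set"
  interpret U: product_prob_space "\<lambda>_ :: nat. uniform_measure lborel {0..1 :: real}"
    by (intro product_prob_spaceI prob_space_uniform_measure) auto
  interpret A: prob_space "height_law m" by (rule prob_space_height_law)
  have U1: "emeasure (uniform_measure lborel {0..1}) (?I i) = ennreal (1 / (2 * real m))" if i: "i \<in> {1..m}" for i
  proof -
    have "0 \<le> (real i - 1/2) / real m" "real i / real m \<le> 1" using i by auto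
    then have "{0..1} \<inter> ?I i = ?I i" by auto
    moreover have "real i / real m - (real i - 1/2) / real m = 1 / (2 * real m)"
      by (simp add: diff_divide_distrib[symmetric])
    moreover have "(real i - 1/2) / real m \<le> real i / real m" by (simp add: divide_right_mono)
    ultimately show ?thesis by (simp add: divide_ennreal_def del: Int_atLeastAtMost)
  qed
  have "emeasure (time_law m) (PiE {1..m} ?I) = (\<Prod>i\<in>{1..m}. emeasure (uniform_measure lborel {0..1}) (?I i))"
    by (intro U.emeasure_PiM) auto
  also have "\<dots> = (\<Prod>i\<in>{1..m}. ennreal (1 / (2 * real m)))"
    by (intro prod.cong refl U1)
  also have "\<dots> = ennreal ((1 / (2 * real m)) ^ m)"
    by (simp add: ennreal_power del: One_nat_def)
  finally have U: "emeasure (time_law m) (PiE {1..m} ?I) = ennreal ((1 / (2 * real m)) ^ m)" .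
  let ?r = "c * (1 / (2 * real m)) powr \<gamma>"
  have A1: "ennreal (?r / (real m)\<^sup>2) \<le> (\<integral>\<^sup>+ x. ennreal (g k x) * indicator (?A k) x \<partial>lborel)" for k
  proof -
    \<comment> \<open>For the starting value this is \<open>1/2 - 1/m >= 1/(2 m)\<close>, which is
      exactly \<open>m >= 3\<close>.\<close>
    have sub: "1 / (2 * real m) \<le> x \<and> x \<le> 1" if "x \<in> ?A k" for x
    proof -
      have "1 / (real m)\<^sup>2 \<le> 1 / (2 * real m)" "1 / (real m)\<^sup>2 \<le> 1 / real m" "1 / real m \<le> 1/3"
        using m by (auto simp: power2_eq_square field_simps)
      moreover have "1 / (2 * real m) = 1 / real m / 2" by simp
      ultimately show ?thesis using that by (auto split: if_splits)
    qed
    have "emeasure lborel (?A k) = ennreal (1 / (real m)\<^sup>2)" by simp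
    then have "ennreal (?r / (real m)\<^sup>2) = (\<integral>\<^sup>+ x. ennreal ?r * indicator (?A k) x \<partial>lborel)"
      using c by (subst nn_integral_cmult_indicator) (auto simp: ennreal_mult[symmetric])
    also have "\<dots> \<le> (\<integral>\<^sup>+ x. ennreal (g k x) * indicator (?A k) x \<partial>lborel)"
    proof (intro nn_integral_mono)
      fix x
      have "?r \<le> g k x" if "x \<in> ?A k"
      proof -
        have "0 \<le> 1 / (2 * real m)" by simp
        then have "?r \<le> c * x powr \<gamma>"
          using sub[OF that] c \<gamma> by (intro mult_left_mono powr_mono2) auto
        also have "\<dots> \<le> g k x"
        proof (rule g_lower)
          show "x \<in> {0..1}" using sub[OF that] \<open>0 \<le> 1 / (2 * real m)\<close> unfolding atLeastAtMost_iff by linarith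
        qed
        finally show ?thesis .
      qed
      then show "ennreal ?r * indicator (?A k) x \<le> ennreal (g k x) * indicator (?A k) x"
        by (auto simp: indicator_def intro: ennreal_leI simp del: if_split)
    qed
    finally show ?thesis .
  qed
  have "ennreal ((?r / (real m)\<^sup>2) ^ (m + 1)) = (\<Prod>k\<le>m. ennreal (?r / (real m)\<^sup>2))"
    using c by (simp add: ennreal_power del: power_Suc)
  also have "\<dots> \<le> (\<Prod>k\<le>m. \<integral>\<^sup>+ x. ennreal (g k x) * indicator (?A k) x \<partial>lborel)"
    by (intro prod_mono_ennreal A1)
  also have "\<dots> = emeasure (height_law m) (PiE {..m} ?A)"
    by (rule emeasure_height_law_box[symmetric]) auto
  finally have A: "ennreal ((?r / (real m)\<^sup>2) ^ (m + 1)) \<le> emeasure (height_law m) (PiE {..m} ?A)" .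
  have "emeasure (coord_law joint_density m) (path_box m) =
      emeasure (time_law m) (PiE {1..m} ?I) * emeasure (height_law m) (PiE {..m} ?A)"
    unfolding path_box_def coord_law_def
    by (intro A.emeasure_pair_measure_Times) (auto intro!: sets_PiM_I_finite)
  moreover have "ennreal (box_mass m) = ennreal ((1 / (2 * real m)) ^ m) * ennreal ((?r / (real m)\<^sup>2) ^ (m + 1))"
    unfolding box_mass_def using c by (intro ennreal_mult) auto
  ultimately show ?thesis using A by (simp only: U mult_left_mono zero_le)
qed

text \<open>Keep only the paths in the box with exactly \<open>m\<close> jumps. They lie below
  \<open>f0\<close>, hence below all points, and their integrals fall short of that of
  \<open>f0\<close> by at most \<open>3 T / m\<close>.\<close>

lemma denominator_ge:
  assumes T: "T > 1" and m: "m \<ge> 3" and N: "countable N" and above: "\<forall>(x, y)\<in>N. f0 x \<le> y"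
    and strip: "N \<subseteq> strip T"
  shows "ennreal (exp (real n * ((LINT x:{0..T}|lborel. f0 x) - 3 * T / real m)) *
      (pmf (poisson_pmf lam) m * box_mass m)) \<le> (\<integral>\<^sup>+ f. likelihood T n N f \<partial>prior T)"
proof -
  let ?E = "exp (real n * ((LINT x:{0..T}|lborel. f0 x) - 3 * T / real m))"
  let ?L = "\<lambda>K. \<integral>\<^sup>+ p. likelihood T n N (step_path T K p) \<partial>coord_law joint_density K"
  have E: "?E \<le> exp (real n * (LINT x:{0..T}|lborel. step_path T m p x))" if p: "p \<in> path_box m" for p
  proof -
    have const: "set_integrable lborel {0..T} (\<lambda>_. 3 / real m)"
      by (intro borel_integrable_atLeastAtMost' continuous_on_const)
    have "(LINT x:{0..T}|lborel. f0 x - 3 / real m) \<le> (LINT x:{0..T}|lborel. step_path T m p x)"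
      using path_box_near_f0(2)[OF m p] integrable_f0
      by (intro set_integral_mono integrable_step_path set_integral_diff(1)[OF integrable_f0 const]) auto
    also have "(LINT x:{0..T}|lborel. f0 x - 3 / real m) = (LINT x:{0..T}|lborel. f0 x) - 3 * T / real m"
      using T by (subst set_integral_diff(2)[OF integrable_f0 const]) (simp add: set_lebesgue_integral_def)
    finally show ?thesis by (simp add: mult_left_mono)
  qed
  have "ennreal (?E * box_mass m) \<le> ennreal ?E * emeasure (coord_law joint_density m) (path_box m)"
    using emeasure_path_box_ge[OF m] by (simp add: ennreal_mult' mult_left_mono)
  also have "\<dots> = (\<integral>\<^sup>+ p. ennreal ?E * indicator (path_box m) p \<partial>coord_law joint_density m)"
    using path_box_sets by (simp add: nn_integral_cmult_indicator)
  also have "\<dots> \<le> ?L m"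
  proof (intro nn_integral_mono)
    fix p
    show "ennreal ?E * indicator (path_box m) p \<le> likelihood T n N (step_path T m p)"
    proof (cases "p \<in> path_box m")
      case True
      have "step_path T m p x \<le> y" if "(x, y) \<in> N" for x y
      proof -
        have "x \<in> {0..T}" using that strip by (auto simp: strip_def)
        then have "step_path T m p x \<le> f0 x" by (rule path_box_near_f0(1)[OF m True])
        also have "f0 x \<le> y" using that above by auto
        finally show ?thesis .
      qed
      then have "\<forall>(x, y)\<in>N. step_path T m p x \<le> y" by auto
      then show ?thesis using E[OF True] True by (simp add: likelihood_def ennreal_leI)
    qed simp
  qed
  finally have box: "ennreal (?E * box_mass m) \<le> ?L m" .
  have "ennreal (?E * (pmf (poisson_pmf lam) m * box_mass m)) = ennreal (?E * box_mass m) * ennreal (pmf (poisson_pmf lam) m)"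
    by (subst ennreal_mult''[symmetric]) (simp_all only: pmf_nonneg mult_ac)
  also have "\<dots> \<le> ?L m * ennreal (pmf (poisson_pmf lam) m)"
    using box by (rule mult_right_mono) simp
  also have "\<dots> = (\<integral>\<^sup>+ K. ?L m * indicator {m} K \<partial>measure_pmf (poisson_pmf lam))"
    by (simp add: nn_integral_cmult emeasure_pmf_single)
  also have "\<dots> \<le> (\<integral>\<^sup>+ K. ?L K \<partial>measure_pmf (poisson_pmf lam))"
    by (intro nn_integral_mono) (auto simp: indicator_def)
  also have "\<dots> = (\<integral>\<^sup>+ f. likelihood T n N f \<partial>prior T)"
    using prob_space_coord_law likelihood_measurable[OF N] by (rule nn_integral_gcpp_prior[symmetric])
  finally show ?thesis .
qed

lemma box_mass_pos:
  assumes "m \<ge> 1"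
  shows "box_mass m > 0"
  using assms c by (auto simp: box_mass_def intro!: mult_pos_pos divide_pos_pos zero_less_power)

text \<open>Each factor contributes a logarithm of order \<open>q * l\<close>, using
  \<open>fact m <= m ^ m\<close>, \<open>m + 1 <= 4 q\<close> and logarithms at most
  \<open>2 l\<close>. The constant 24 is 4 from the factorial, 4 from the time windows and 16 from
  the widths \<open>1 / m^2\<close>.\<close>

lemma pmf_box_mass_ge:
  assumes m: "m \<ge> 1" "real m \<le> 2 * q" and l: "1 \<le> l" "ln (2 * real m) \<le> 2 * l"
  shows "exp (- (lam + (2 * \<bar>ln lam\<bar> + 4 * \<bar>ln c\<bar> + 8 * \<gamma> + 24) * (q * l))) \<le>
    pmf (poisson_pmf lam) m * box_mass m"
proof -
  let ?L = "ln (2 * real m)"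
  have m0: "real m > 0" and q: "q \<ge> 0" using m by auto
  have ln_m: "ln (real m) \<le> ?L" "?L \<ge> 0" using m by auto
  have lnm0: "ln (real m) \<ge> 0" using m by auto
  have fact_le: "fact m \<le> exp (real m * ln (real m))"
  proof -
    have "fact m \<le> real (m ^ m)" by (rule fact_le_power)
    also have "\<dots> = exp (real m * ln (real m))" using m0 by (simp add: exp_of_nat_mult)
    finally show ?thesis .
  qed
  have "exp (- lam) * exp (real m * ln lam) * exp (- (real m * ln (real m))) \<le> pmf (poisson_pmf lam) m"
  proof -
    have "exp (real m * ln lam) = lam ^ m" using lam by (simp add: exp_of_nat_mult)
    moreover have "exp (- (real m * ln (real m))) \<le> 1 / fact m"
      using fact_le by (simp add: exp_minus field_simps)
    ultimately have prod_le: "exp (- lam) * exp (real m * ln lam) * exp (- (real m * ln (real m))) \<le> exp (- lam) * lam ^ m * (1 / fact m)"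
      using lam by (intro mult_mono) auto
    then show ?thesis using lam by (simp add: mult_ac)
  qed
  moreover have "box_mass m = exp (- (real m * ?L)) * exp (real (m + 1) * (ln c - \<gamma> * ?L - 2 * ln (real m)))"
  proof -
    have 1: "1 / (2 * real m) = exp (- ?L)" using m0 by (simp add: exp_minus field_simps)
    have 2: "c * (1 / (2 * real m)) powr \<gamma> / (real m)\<^sup>2 = exp (ln c - \<gamma> * ?L - 2 * ln (real m))"
    proof -
      have "c = exp (ln c)" using c by simp
      moreover have "(1 / (2 * real m)) powr \<gamma> = exp (- (\<gamma> * ?L))"
        unfolding 1 by (simp add: powr_def)
      moreover have "(real m)\<^sup>2 = exp (2 * ln (real m))"
        using m0 by (simp only: exp_double exp_ln)
      moreover have "exp (ln c - \<gamma> * ?L - 2 * ln (real m)) = exp (ln c) * exp (- (\<gamma> * ?L)) / exp (2 * ln (real m))"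
        by (simp add: exp_diff exp_minus divide_inverse)
      ultimately show ?thesis by (simp only:)
    qed
    have "(1 / (2 * real m)) ^ m = exp (- (real m * ?L))"
      unfolding 1 by (simp add: exp_of_nat_mult[symmetric])
    then show ?thesis unfolding box_mass_def 2 by (simp only: exp_of_nat_mult[symmetric])
  qed
  ultimately have prod_le: "exp (- lam) * exp (real m * ln lam) * exp (- (real m * ln (real m))) *
      (exp (- (real m * ?L)) * exp (real (m + 1) * (ln c - \<gamma> * ?L - 2 * ln (real m)))) \<le>
      pmf (poisson_pmf lam) m * box_mass m"
    by (intro mult_mono) auto
  have "- (lam + (2 * \<bar>ln lam\<bar> + 4 * \<bar>ln c\<bar> + 8 * \<gamma> + 24) * (q * l)) \<le>
      - lam + real m * ln lam + - (real m * ln (real m)) +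
      (- (real m * ?L) + real (m + 1) * (ln c - \<gamma> * ?L - 2 * ln (real m)))"
  proof -
    have ql: "q \<le> q * l" using q l mult_left_mono[of 1 l q] by simp
    have a: "- (2 * \<bar>ln lam\<bar> * (q * l)) \<le> real m * ln lam"
    proof -
      have "real m * \<bar>ln lam\<bar> \<le> (2 * (q * l)) * \<bar>ln lam\<bar>"
        using m ql by (intro mult_right_mono) linarith+
      moreover have "- (real m * \<bar>ln lam\<bar>) \<le> real m * ln lam"
        using mult_left_mono[of "- \<bar>ln lam\<bar>" "ln lam" "real m"] by simp
      ultimately show ?thesis by (simp add: mult_ac)
    qed
    have "real m * ?L \<le> 2 * q * (2 * l)" using m l ln_m q by (intro mult_mono) auto
    then have b: "real m * ?L \<le> 4 * (q * l)" by simp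
    have "real m * ln (real m) \<le> real m * ?L" using ln_m by (intro mult_left_mono) auto
    then have d: "real m * ln (real m) \<le> 4 * (q * l)" using b by linarith
    have "real (m + 1) * (\<bar>ln c\<bar> + \<gamma> * ?L + 2 * ln (real m)) \<le> (4 * q) * (\<bar>ln c\<bar> * l + \<gamma> * (2 * l) + 2 * (2 * l))"
    proof (intro mult_mono add_mono)
      show "real (m + 1) \<le> 4 * q" using m by simp
      show "\<bar>ln c\<bar> \<le> \<bar>ln c\<bar> * l" using l mult_left_mono[of 1 l "\<bar>ln c\<bar>"] by simp
      show "ln (real m) \<le> 2 * l" using ln_m l by linarith
    qed (use \<gamma> l q ln_m lnm0 in auto)
    moreover have "- (real (m + 1) * (\<bar>ln c\<bar> + \<gamma> * ?L + 2 * ln (real m))) \<le> real (m + 1) * (ln c - \<gamma> * ?L - 2 * ln (real m))"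
    proof -
      have "- (\<bar>ln c\<bar> + \<gamma> * ?L + 2 * ln (real m)) \<le> ln c - \<gamma> * ?L - 2 * ln (real m)" by linarith
      from mult_left_mono[OF this of_nat_0_le_iff, of "m + 1"] show ?thesis by (simp only: mult_minus_right)
    qed
    ultimately have "- ((4 * \<bar>ln c\<bar> + 8 * \<gamma> + 16) * (q * l)) \<le> real (m + 1) * (ln c - \<gamma> * ?L - 2 * ln (real m))"
      by (simp add: algebra_simps)
    with a b d show ?thesis by (simp add: algebra_simps)
  qed
  then have "exp (- (lam + (2 * \<bar>ln lam\<bar> + 4 * \<bar>ln c\<bar> + 8 * \<gamma> + 24) * (q * l))) \<le>
      exp (- lam) * exp (real m * ln lam) * exp (- (real m * ln (real m))) *
      (exp (- (real m * ?L)) * exp (real (m + 1) * (ln c - \<gamma> * ?L - 2 * ln (real m))))"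
    by (simp only: exp_add[symmetric] exp_le_cancel_iff)
  then show ?thesis using prod_le by (rule order_trans)
qed

section \<open>The expected posterior mass and the choice of parameters\<close>

text \<open>The first two terms are the probabilities that no low point occurs after time 1 and that
  too many squares are void; there the posterior is bounded by 1. Elsewhere the numerator and
  denominator bounds apply, and the integral of \<open>f0\<close> cancels in their ratio.\<close>

lemma expected_posterior_le:
  assumes P: "is_model_law T n f0 P" and T: "T > 1"
    and J: "J \<ge> 1" "4 * J\<^sup>2 \<le> n" "1 / real J < b" and z: "z \<ge> 1" and m: "m \<ge> 3"
  shows "(\<integral>\<^sup>+ N. posterior T n (prior T) N {f. theta f \<ge> theta f0 - b} \<partial>P) \<le>
    ennreal (exp (- (real n * (T - 1) / real J)) + 2 / (b * real J - 1) +
      exp (real n * (T * b + 3 * T / real m)) * (exp (lam * (z - 1)) * z powr (1 - 1 / (24 * b))) /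
        (pmf (poisson_pmf lam) m * box_mass m))"
proof -
  interpret P: prob_space P using P by (auto simp: is_model_law_def prob_space_poisson_process_law)
  have b: "b > 0" using J by (meson divide_nonneg_nonneg le_less_trans of_nat_0_le_iff zero_le_one)
  \<comment> \<open>The threshold at which the integrated majorant reaches \<open>b\<close>.\<close>
  define s where "s = (b - 1 / real J) * (real J)\<^sup>2"
  have s: "s > 0" using J by (simp add: s_def)
  let ?I = "LINT x:{0..T}|lborel. f0 x"
  let ?A = "{N \<in> space P. N \<inter> ({1..T} \<times> {3/2..3/2 + 1 / real J}) = {}}"
  let ?S = "{N \<in> space P. (\<Sum>j<J. void_count J j N) \<ge> s}"
  let ?t = "exp (lam * (z - 1)) * z powr (1 - 1 / (24 * b))"
  let ?w = "pmf (poisson_pmf lam) m * box_mass m"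
  let ?R = "exp (real n * (T * b + 3 * T / real m)) * ?t / ?w"
  have w: "?w > 0" using box_mass_pos[of m] m lam by (intro mult_pos_pos) auto
  have A_sets [measurable]: "?A \<in> P.events"
    using P unfolding is_model_law_def
    by (intro sets_void_event) (auto simp: borel_prod[symmetric])
  have S_sets [measurable]: "?S \<in> P.events"
    using sum_void_count_measurable[OF P, of J] by measurable
  have "AE N in P. posterior T n (prior T) N {f. theta f \<ge> theta f0 - b} \<le>
      indicator ?A N + indicator ?S N + ennreal ?R"
    using AE_points_above_boundary[OF P f0_measurable] AE_space
  proof eventually_elim
    case (elim N)
    have "N \<in> locally_finite_configs (strip T)"
      using elim P space_poisson_process_law by (simp add: is_model_law_def)
    then have N: "countable N" "N \<subseteq> strip T"
      using countable_locally_finite_configs by (auto simp: locally_finite_configs_def)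
    show ?case
    proof (cases "N \<in> ?A \<or> N \<in> ?S")
      case True
      have "posterior T n (prior T) N {f. theta f \<ge> theta f0 - b} \<le> 1" by (rule posterior_le_1)
      also have "1 \<le> indicator ?A N + (indicator ?S N :: ennreal)" using True by (auto simp: indicator_def)
      also have "\<dots> \<le> indicator ?A N + indicator ?S N + ennreal ?R" by simp
      finally show ?thesis .
    next
      case False
      then have last: "N \<inter> ({1..T} \<times> {3/2..3/2 + 1 / real J}) \<noteq> {}"
        and "(\<Sum>j<J. void_count J j N) < s" using elim by auto
      then have "(\<Sum>j<J. void_count J j N) / (real J)\<^sup>2 \<le> s / (real J)\<^sup>2"
        by (intro divide_right_mono) auto
      then have voids: "1 / real J + (\<Sum>j<J. void_count J j N) / (real J)\<^sup>2 \<le> b"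
        using J by (simp add: s_def)
      have "posterior T n (prior T) N {f. theta f \<ge> theta f0 - b} \<le>
          ennreal (exp (real n * (?I + T * b)) * ?t / (exp (real n * (?I - 3 * T / real m)) * ?w))"
        unfolding posterior_def
        using numerator_le[OF T J(1) b z N(1) last voids, of n] denominator_ge[OF T m N(1) elim(1) N(2), of n] w
        by (intro ennreal_divide_le_divide) auto
      also have "exp (real n * (?I + T * b)) * ?t / (exp (real n * (?I - 3 * T / real m)) * ?w) = ?R"
      proof -
        have "exp (real n * (?I + T * b)) = exp (real n * (?I - 3 * T / real m)) * exp (real n * (T * b + 3 * T / real m))"
          by (simp add: exp_add[symmetric] algebra_simps)
        then show ?thesis by simp
      qed
      also have "ennreal ?R \<le> indicator ?A N + indicator ?S N + ennreal ?R" by simp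
      finally show ?thesis .
    qed
  qed
  then have "(\<integral>\<^sup>+ N. posterior T n (prior T) N {f. theta f \<ge> theta f0 - b} \<partial>P) \<le>
      (\<integral>\<^sup>+ N. indicator ?A N + indicator ?S N + ennreal ?R \<partial>P)"
    by (rule nn_integral_mono_AE)
  also have "\<dots> = emeasure P ?A + emeasure P ?S + ennreal ?R"
    by (simp add: nn_integral_add P.emeasure_space_1)
  also have "\<dots> = ennreal (measure P ?A + measure P ?S + ?R)"
    using w by (simp add: P.emeasure_eq_measure)
  also have "\<dots> \<le> ennreal (exp (- (real n * (T - 1) / real J)) + 2 / (b * real J - 1) + ?R)"
  proof (intro ennreal_leI add_mono order_refl)
    have "measure P ?A = exp (- (real n * (T - 1) * (3/2 + 1 / real J - 3/2)))"
      using T by (intro prob_rectangle_void[OF P]) (auto simp: f0_def)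
    then show "measure P ?A \<le> exp (- (real n * (T - 1) / real J))" by simp
    have "measure P ?S \<le> 2 * real J / s" by (rule prob_many_voids_le[OF P T J(1,2) s])
    also have "2 * real J / s = 2 * real J / ((b * real J - 1) * real J)"
      using J by (simp add: s_def power2_eq_square field_simps)
    also have "\<dots> = 2 / (b * real J - 1)" using J by simp
    finally show "measure P ?S \<le> 2 / (b * real J - 1)" .
  qed
  finally show ?thesis .
qed


text \<open>On the scale \<open>sqrt (n ln n)\<close>, the expression in absolute values and \<open>\<gamma>\<close> is the exponent lost to
  the prior mass in the denominator, \<open>4 T\<close> bounds the loss in the likelihood ratio, and the final
  \<open>1\<close> is the exponent that remains.\<close>

definition rate_const :: "real \<Rightarrow> real" where
  "rate_const T = 1 / (96 * (4 * T + (2 * \<bar>ln lam\<bar> + 4 * \<bar>ln c\<bar> + 8 * \<gamma> + 24) + 1))"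

lemma rate_const_pos:
  assumes "T > 1"
  shows "rate_const T > 0"
proof -
  have "0 \<le> 2 * \<bar>ln lam\<bar> + 4 * \<bar>ln c\<bar> + 8 * \<gamma>" using \<gamma> by simp
  then show ?thesis using assms unfolding rate_const_def by (intro divide_pos_pos mult_pos_pos) linarith+
qed

lemma expected_posterior_le_explicit:
  assumes P: "is_model_law T n f0 P" and T: "T > 1"
    and n: "n \<ge> 16" "ln (real n) \<ge> 1" "sqrt (real n / ln (real n)) \<ge> 3"
      "sqrt (real n / ln (real n)) + 1 \<le> real n / 2" "rate_const T * sqrt (ln (real n)) / 4 > 1"
  shows "(\<integral>\<^sup>+ N. posterior T n (prior T) N
      {f. theta f \<ge> theta f0 - rate_const T * sqrt (ln (real n) / real n)} \<partial>P) \<le>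
    ennreal (exp (- (2 * (T - 1) * sqrt (real n))) + 2 / (rate_const T * sqrt (ln (real n)) / 4 - 1) +
      exp (lam * real n powr (1/4) + ln (real n) / 4 - sqrt (real n * ln (real n))))"
proof -
  define l where "l = ln (real n)"
  define q where "q = sqrt (real n / l)"
  define L where "L = sqrt (real n * l)"
  define ct where "ct = rate_const T"
  define b where "b = ct * sqrt (l / real n)"
  \<comment> \<open>The largest \<open>J\<close> allowed by \<open>4 J^2 <= n\<close>.\<close>
  define J where "J = nat \<lfloor>sqrt (real n) / 2\<rfloor>"
  \<comment> \<open>This balances the approximation loss \<open>n / m\<close> against the prior cost
    \<open>m * ln n\<close>; both are of order \<open>L\<close>.\<close>
  define m where "m = nat \<lceil>q\<rceil>"
  \<comment> \<open>Then \<open>ln z = l / 4\<close> contributes the logarithm to the tail exponent,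
    while \<open>lam * z\<close> remains negligible against \<open>L\<close>.\<close>
  define z where "z = real n powr (1/4)"
  define C where "C = 2 * \<bar>ln lam\<bar> + 4 * \<bar>ln c\<bar> + 8 * \<gamma> + 24"
  have C: "C \<ge> 0" using \<gamma> by (simp add: C_def)
  have ct_eq: "ct = 1 / (96 * (4 * T + C + 1))" by (simp add: ct_def rate_const_def C_def)
  have ct: "ct > 0" "ct \<le> 1" using T C by (auto simp: ct_eq divide_le_eq)
  have l: "l \<ge> 1" and n0: "real n \<ge> 16" using n by (auto simp: l_def)
  have q: "q \<ge> 3" "q + 1 \<le> real n / 2" using n by (auto simp: q_def l_def)
  have sn: "sqrt (real n) \<ge> 4" using n0 by (intro real_le_rsqrt) simp
  have J_le: "real J \<le> sqrt (real n) / 2" unfolding J_def using sn by simp linarith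
  have "sqrt (real n) / 2 < real J + 1" unfolding J_def using sn by linarith
  then have J_ge: "real J \<ge> sqrt (real n) / 4" "real J > 0" using sn by linarith+
  have J1: "J \<ge> 1" using J_ge by simp
  have J2: "4 * J\<^sup>2 \<le> n"
  proof -
    have "(2 * real J)\<^sup>2 \<le> (sqrt (real n))\<^sup>2" using J_le by (intro power_mono) auto
    then have "real (4 * J\<^sup>2) \<le> real n" by simp
    then show ?thesis by (simp only: of_nat_le_iff)
  qed
  have bJ: "ct * sqrt l / 4 \<le> b * real J"
  proof -
    have "ct * sqrt l / 4 = b * (sqrt (real n) / 4)"
      using n0 by (simp add: b_def real_sqrt_divide)
    also have "\<dots> \<le> b * real J" using J_ge ct l by (intro mult_left_mono) (auto simp: b_def)
    finally show ?thesis .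
  qed
  have gt1: "ct * sqrt l / 4 > 1" using n by (simp add: ct_def l_def)
  then have bJ1: "b * real J > 1" using bJ by linarith
  then have J3: "1 / real J < b" using J_ge by (simp add: divide_less_eq)
  have m: "q \<le> real m" "real m \<le> q + 1" unfolding m_def using q by linarith+
  then have m3: "m \<ge> 3" using q by linarith
  have z1: "z \<ge> 1" unfolding z_def using n0 by (intro ge_one_powr_ge_zero) auto
  have ql: "q * l = L"
  proof -
    have "q * l = sqrt (real n) / sqrt l * (sqrt l * sqrt l)" using l by (simp add: q_def real_sqrt_divide)
    also have "\<dots> = sqrt (real n) * sqrt l" using l by (simp del: real_sqrt_mult_self)
    finally show ?thesis by (simp add: L_def real_sqrt_mult)
  qed
  have nb: "real n * b = ct * L"
  proof -
    have "real n * sqrt (l / real n) = (sqrt (real n) * sqrt (real n)) * sqrt (l / real n)" by simp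
    also have "\<dots> = L" using n0 by (simp add: L_def real_sqrt_divide real_sqrt_mult del: real_sqrt_mult_self)
    finally show ?thesis by (simp add: b_def)
  qed
  have L: "L \<ge> 0" using l by (simp add: L_def)
  have nm: "real n / real m \<le> L"
  proof -
    have "real n / real m \<le> real n / q" using m q by (intro divide_left_mono) auto
    also have "\<dots> = L"
    proof -
      have "q * L = sqrt (real n / l) * sqrt l * sqrt (real n)" by (simp add: q_def L_def real_sqrt_mult)
      also have "\<dots> = real n" using l by (simp add: real_sqrt_divide)
      finally show ?thesis using q by (simp add: field_simps)
    qed
    finally show ?thesis .
  qed
  have lnz: "ln z = l / 4" using n0 by (simp add: z_def l_def ln_powr)
  \<comment> \<open>The exponent gained from the forced number of jumps; the 96 in
    \<open>rate_const\<close> is the 24 of the jump bound times the 4 of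
    \<open>ln z\<close>.\<close>
  have inv_b: "1 / (24 * b) * (l / 4) = (4 * T + C + 1) * L"
  proof -
    have "1 / b = q / ct"
      using ct l n0 by (simp add: b_def q_def real_sqrt_divide field_simps)
    moreover have "1 / (24 * b) * (l / 4) = 1 / b * l / 96" by simp
    ultimately have "1 / (24 * b) * (l / 4) = q * l / (96 * ct)" by (simp only:) simp
    also have "\<dots> = L * (1 / (96 * ct))" by (simp add: ql)
    also have "1 / (96 * ct) = 4 * T + C + 1" by (simp add: ct_eq)
    finally show ?thesis by (simp add: mult.commute)
  qed
  have w_ge: "exp (- (lam + C * L)) \<le> pmf (poisson_pmf lam) m * box_mass m"
  proof -
    have "2 * real m \<le> real n * 1" using m q by simp
    also have "\<dots> \<le> real n * real n" using n0 by (intro mult_left_mono) auto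
    finally have "ln (2 * real m) \<le> ln (real n * real n)" using m3 by (subst ln_le_cancel_iff) auto
    also have "\<dots> = 2 * l" using n0 by (simp add: ln_mult l_def)
    finally show ?thesis
      using pmf_box_mass_ge[of m q l] m q l m3 by (simp add: ql C_def)
  qed
  have "exp (real n * (T * b + 3 * T / real m)) * (exp (lam * (z - 1)) * z powr (1 - 1 / (24 * b))) /
        (pmf (poisson_pmf lam) m * box_mass m) \<le>
      exp (real n * (T * b + 3 * T / real m)) * (exp (lam * (z - 1)) * z powr (1 - 1 / (24 * b))) /
        exp (- (lam + C * L))"
  proof (rule divide_left_mono[OF w_ge])
    show "0 < pmf (poisson_pmf lam) m * box_mass m * exp (- (lam + C * L))"
      using box_mass_pos[of m] m3 lam by (intro mult_pos_pos) auto
  qed auto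
  also have "\<dots> = exp (real n * (T * b + 3 * T / real m) + lam * (z - 1) + (1 - 1 / (24 * b)) * (l / 4) + (lam + C * L))"
  proof -
    have "z powr (1 - 1 / (24 * b)) = exp ((1 - 1 / (24 * b)) * (l / 4))"
      using z1 by (simp add: powr_def lnz)
    then show ?thesis by (simp only: exp_minus divide_inverse inverse_inverse_eq exp_add mult.assoc)
  qed
  \<comment> \<open>The likelihood ratio costs at most \<open>T * L\<close> through
    \<open>b\<close>, as \<open>ct <= 1\<close>, and \<open>3 * T * L\<close> through
    \<open>m\<close>; the prior mass costs \<open>C * L\<close>. The gain
    \<open>(4 * T + C + 1) * L\<close> leaves \<open>- L\<close>.\<close>
  also have "\<dots> \<le> exp (lam * z + l / 4 - L)"
  proof -
    have "real n * (T * b + 3 * T / real m) = T * (real n * b) + 3 * T * (real n / real m)"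
      by (simp add: algebra_simps)
    also have "\<dots> \<le> T * L + 3 * T * L"
      unfolding nb using nm T ct L by (intro add_mono mult_left_mono mult_left_le_one_le) auto
    finally have "real n * (T * b + 3 * T / real m) \<le> 4 * T * L" by (simp add: mult.commute[of L T])
    moreover have "(1 - 1 / (24 * b)) * (l / 4) = l / 4 - (4 * T + C + 1) * L"
      using inv_b by (simp add: left_diff_distrib)
    ultimately show ?thesis by (simp add: algebra_simps)
  qed
  finally have e3: "exp (real n * (T * b + 3 * T / real m)) * (exp (lam * (z - 1)) * z powr (1 - 1 / (24 * b))) /
        (pmf (poisson_pmf lam) m * box_mass m) \<le> exp (lam * z + l / 4 - L)" .
  have e1: "exp (- (real n * (T - 1) / real J)) \<le> exp (- (2 * (T - 1) * sqrt (real n)))"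
  proof -
    have "2 * sqrt (real n) * real J \<le> 2 * sqrt (real n) * (sqrt (real n) / 2)"
      using J_le by (intro mult_left_mono) auto
    also have "\<dots> = real n" by simp
    finally have "2 * sqrt (real n) \<le> real n / real J" using J_ge by (simp add: le_divide_eq)
    then have "(T - 1) * (2 * sqrt (real n)) \<le> (T - 1) * (real n / real J)" using T by (intro mult_left_mono) auto
    then have "2 * (T - 1) * sqrt (real n) \<le> real n * (T - 1) / real J" by (simp add: algebra_simps)
    then show ?thesis unfolding exp_le_cancel_iff neg_le_iff_le .
  qed
  have e2: "2 / (b * real J - 1) \<le> 2 / (ct * sqrt l / 4 - 1)"
    using bJ gt1 by (intro divide_left_mono) auto
  have "(\<integral>\<^sup>+ N. posterior T n (prior T) N {f. theta f \<ge> theta f0 - b} \<partial>P) \<le>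
    ennreal (exp (- (2 * (T - 1) * sqrt (real n))) + 2 / (ct * sqrt l / 4 - 1) + exp (lam * z + l / 4 - L))"
    by (rule order_trans[OF expected_posterior_le[OF P T J1 J2 J3 z1 m3]])
      (intro ennreal_leI add_mono e1 e2 e3)
  then show ?thesis by (simp add: b_def ct_def l_def z_def L_def)
qed

lemma expected_posterior_tendsto_0:
  assumes T: "T > 1" and P: "\<And>n. is_model_law T n f0 (P n)"
  shows "(\<lambda>n. \<integral>\<^sup>+ N. posterior T n (prior T) N
        {f. theta f \<ge> theta f0 - rate_const T * sqrt (ln (real n) / real n)} \<partial>P n) \<longlonglongrightarrow> 0"
proof -
  define ct where "ct = rate_const T"
  have ct: "ct > 0" using T by (simp add: ct_def rate_const_pos)
  have ev: "eventually (\<lambda>n::nat. n \<ge> 16 \<and> ln (real n) \<ge> 1 \<and> sqrt (real n / ln (real n)) \<ge> 3 \<and>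
      sqrt (real n / ln (real n)) + 1 \<le> real n / 2 \<and> ct * sqrt (ln (real n)) / 4 > 1) sequentially"
    using ct by (intro eventually_conj; real_asymp)
  \<comment> \<open>The middle term, of order \<open>1 / sqrt (ln n)\<close>, is the slowest; it
    comes from Markov's inequality for the void squares.\<close>
  have lim: "(\<lambda>n::nat. exp (- (2 * (T - 1) * sqrt (real n))) + 2 / (ct * sqrt (ln (real n)) / 4 - 1) +
      exp (lam * real n powr (1/4) + ln (real n) / 4 - sqrt (real n * ln (real n)))) \<longlonglongrightarrow> 0"
    using ct T lam by real_asymp
  from tendsto_ennrealI[OF this]
  have lim': "(\<lambda>n::nat. ennreal (exp (- (2 * (T - 1) * sqrt (real n))) + 2 / (ct * sqrt (ln (real n)) / 4 - 1) +
      exp (lam * real n powr (1/4) + ln (real n) / 4 - sqrt (real n * ln (real n))))) \<longlonglongrightarrow> 0" by simp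
  show "(\<lambda>n. \<integral>\<^sup>+ N. posterior T n (prior T) N
        {f. theta f \<ge> theta f0 - rate_const T * sqrt (ln (real n) / real n)} \<partial>P n) \<longlonglongrightarrow> 0"
  proof (rule tendsto_sandwich[OF _ _ tendsto_const lim'])
    show "\<forall>\<^sub>F n in sequentially. (\<integral>\<^sup>+ N. posterior T n (prior T) N
        {f. theta f \<ge> theta f0 - rate_const T * sqrt (ln (real n) / real n)} \<partial>P n) \<le>
      ennreal (exp (- (2 * (T - 1) * sqrt (real n))) + 2 / (ct * sqrt (ln (real n)) / 4 - 1) +
        exp (lam * real n powr (1/4) + ln (real n) / 4 - sqrt (real n * ln (real n))))"
      using ev
    proof eventually_elim
      case (elim n)
      then show ?case
        unfolding ct_def by (intro expected_posterior_le_explicit[OF P T]) auto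
    qed
  qed simp
qed

end

theorem theorem5p7:
  fixes T lam c \<gamma> :: real
    and g :: "nat \<Rightarrow> real \<Rightarrow> real"
  assumes T: "T > 1" and lam: "lam > 0"
    and g_meas: "\<And>k. g k \<in> borel_measurable borel"
    and g_nonneg: "\<And>k x. g k x \<ge> 0"
    and g_int: "\<And>k. (\<integral>\<^sup>+ x. ennreal (g k x) \<partial>lborel) = 1"
    and c: "c > 0" and \<gamma>: "\<gamma> \<ge> 0"
    and g_lower: "\<And>k x. x \<in> {0..1} \<Longrightarrow> g k x \<ge> c * x powr \<gamma>"
    and g_supp: "\<And>k x. k \<ge> 1 \<Longrightarrow> x < 0 \<Longrightarrow> g k x = 0"
  shows "\<exists>ct > 0. \<forall>P. (\<forall>n. is_model_law T n f0 (P n)) \<longrightarrow>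
    (\<lambda>n. \<integral>\<^sup>+ N. posterior T n (gcpp_prior T lam (\<lambda>K a. \<Prod>k\<le>K. g k (a k))) N
              {f. theta f \<ge> theta f0 - ct * sqrt (ln (real n) / real n)} \<partial>P n)
      \<longlonglongrightarrow> 0"
proof -
  interpret jump_prior lam c \<gamma> g
    by standard (use assms in auto)
  show ?thesis
    using rate_const_pos[OF T] expected_posterior_tendsto_0[OF T] by blast
qed

end
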